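(* Let $\mathcal{C}$ be a uni-fractionable category. Its fraction category $\mathrm{Frac}\,\mathcal{C}$ has the following properties. (a) The object set of $\mathrm{Frac}\,\mathcal{C}$ is the object set of $\mathcal{C}$, and its morphisms are the double fractions $b\backslash f/a$, i.e. the fraction-equality classes of $3$-arrows $(b,f,a)$ in $\mathcal{C}$. Source and target of $b\backslash f/a$ are the target of $b$ and the source of $a$, respectively. Given $3$-arrows $(b_1,f_1,a_1)$, $(b_2,f_2,a_2)$ such that the target of $b_1\backslash f_1/a_1$ equals the source of $b_2\backslash f_2/a_2$, the composite of the double fractions can be constructed as follows: one chooses denominators $d,d',e,e'$ and morphisms $g_1,g_2$ in $\mathcal{C}$ with $b_2a_1=de$, $g_1e=e'f_1$, $dg_2=f_2d'$; then $$(b_1\backslash f_1/a_1)(b_2\backslash f_2/a_2)=e'b_1\backslash g_1g_2/a_2d'.$$ The identity of an object $X$ in $\mathrm{Frac}\,\mathcal{C}$ is $1_X\backslash 1_X/1_X$. (b) $\mathrm{Frac}\,\mathcal{C}$ is a localisation of $\mathcal{C}$ (with respect to $\mathrm{Den}\,\mathcal{C}$), where the localisation functor $\mathrm{loc}\colon\mathcal{C}\to\mathrm{Frac}\,\mathcal{C}$ is given by $\mathrm{loc}(X)=X$ on objects and $\mathrm{loc}(f)=1\backslash f/1$ on morphisms. For $d\in\mathrm{Den}\,\mathcal{C}$ the inverse of $\mathrm{loc}(d)$ is $\mathrm{loc}(d)^{-1}=d\backslash 1/1=1\backslash 1/d$. Given a functor $F\colon\mathcal{C}\to\mathcal{D}$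 such that $Fd$ is invertible for all $d\in\mathrm{Den}\,\mathcal{C}$, the unique functor $\hat F\colon\mathrm{Frac}\,\mathcal{C}\to\mathcal{D}$ with $F=\hat F\circ\mathrm{loc}$ is given by $\hat F(b\backslash f/a)=(Fb)^{-1}(Ff)(Fa)^{-1}$. Given functors $F,G\colon\mathcal{C}\to\mathcal{D}$ such that $Fd$ and $Gd$ are invertible for all $d\in\mathrm{Den}\,\mathcal{C}$, and a natural transformation $\alpha\colon F\to G$, the unique natural transformation $\hat\alpha\colon\hat F\to\hat G$ with $\alpha_X=\hat\alpha_{\mathrm{loc}(X)}$ for all $X\in\mathrm{Ob}\,\mathcal{C}$ is given by $\hat\alpha_X=\alpha_X$ for $X\in\mathrm{Ob}\,\mathrm{Frac}\,\mathcal{C}=\mathrm{Ob}\,\mathcal{C}$. (c) Let $(b_1,f_1,a_1)$, $(b_2,f_2,a_2)$ be $3$-arrows and $(p_1,g_1,i_1)$, $(p_2,g_2,i_2)$ be normal $3$-arrows in $\mathcal{C}$, such that both composites in the following equation are defined. Then $$(b_1\backslash f_1/a_1)(p_2\backslash g_2/i_2)=(p_1\backslash g_1/i_1)(b_2\backslash f_2/a_2)$$ in $\mathrm{Frac}\,\mathcal{C}$ if and only if there exist $3$-arrows $(\tilde b_1,\tilde f_1,\tilde a_1)$, $(\tilde b_2,\tilde f_2,\tilde a_2)$ and normal $3$-arrows $(\tilde p_1,\tilde g_1,\tilde i_1)$, $(\tilde p_2,\tilde g_2,\tilde i_2)$ in $\mathcal{C}$ (with sources and targets such that all the following composites are defined)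 satisfying $$\tilde b_1p_1=\tilde p_1b_1,\quad \tilde f_1\tilde p_2=\tilde p_1f_1,\quad \tilde a_1\tilde p_2=p_2a_1,$$ $$\tilde b_1g_1=\tilde g_1\tilde b_2,\quad \tilde f_1\tilde g_2=\tilde g_1\tilde f_2,\quad \tilde a_1\tilde g_2=g_2\tilde a_2,$$ $$b_2i_1=\tilde i_1\tilde b_2,\quad f_2\tilde i_2=\tilde i_1\tilde f_2,\quad a_2\tilde i_2=i_2\tilde a_2,$$ i.e. fitting into a commutative diagram with rows $(b_1,f_1,a_1)$, $(\tilde b_1,\tilde f_1,\tilde a_1)$, $(\tilde b_2,\tilde f_2,\tilde a_2)$, $(b_2,f_2,a_2)$ and columns $(p_1,g_1,i_1)$, $(\tilde p_1,\tilde g_1,\tilde i_1)$, $(\tilde p_2,\tilde g_2,\tilde i_2)$, $(p_2,g_2,i_2)$.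
   Context: Composition is written diagrammatically: for $f\colon X\to Y$, $g\colon Y\to Z$ the composite is $fg\colon X\to Z$ (but functors are composed as $G\circ F$). A category with denominators is a category $\mathcal{C}$ together with a subset $\mathrm{Den}\,\mathcal{C}\subseteq\mathrm{Mor}\,\mathcal{C}$, whose elements are called denominators. A subset $D\subseteq\mathrm{Mor}\,\mathcal{C}$ is multiplicative if it contains all identities and is closed under composition; it is semi-saturated if it is multiplicative and, for composable $f,g$, whenever two of $f,g,fg$ are in $D$, so is the third. A uni-fractionable category is a category with denominators $\mathcal{C}$ with $\mathrm{Den}\,\mathcal{C}$ semi-saturated, together with multiplicative subsets $\mathrm{SDen}\,\mathcal{C},\mathrm{TDen}\,\mathcal{C}\subseteq\mathrm{Den}\,\mathcal{C}$ (S-denominators, T-denominators) such that: (WU) for $i\in\mathrm{SDen}\,\mathcal{C}$ and a morphism $f$ with the same source as $i$ there is a weak pushout square $if'=fi'$ of $i$ and $f$ with $i'\in\mathrm{SDen}\,\mathcal{C}$; dually, for $p\in\mathrm{TDen}\,\mathcal{C}$ and a morphism $f$ with the same target as $p$ there is a weak pullback square $f'p=p'f$ of $f$ and $p$ with $p'\in\mathrm{TDen}\,\mathcal{C}$; (Fac) for every $d\in\mathrm{Den}\,\mathcal{C}$ there are $i\in\mathrm{SDen}\,\mathcal{C}$, $p\in\mathrm{TDen}\,\mathcal{C}$ with $d=ip$. (A weak pushout/pullback satisfies the universal property of a pushout/pullback except for uniqueness of the induced morphism.) A $3$-arrow $(b,f,a)\colon X\leftarrow\tilde X\to\tilde Y\leftarrow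 Y$ in $\mathcal{C}$ consists of denominators $b\colon\tilde X\to X$, $a\colon Y\to\tilde Y$ and a morphism $f\colon\tilde X\to\tilde Y$; its source is $X$ and its target is $Y$. It is normal if $b$ is a T-denominator and $a$ is an S-denominator. Fraction equality is the equivalence relation $\equiv$ on the set of $3$-arrows generated by: $(b,f,a)\equiv(b,fc,ac)$ for every morphism $c$ with $ac\in\mathrm{Den}\,\mathcal{C}$, and $(b,f,a)\equiv(cb,cf,a)$ for every morphism $c$ with $cb\in\mathrm{Den}\,\mathcal{C}$. Fraction equal $3$-arrows have the same source and the same target. The class of $(b,f,a)$ is the double fraction $b\backslash f/a$. The fraction category $\mathrm{Frac}\,\mathcal{C}$ is the category with $\mathrm{Ob}\,\mathrm{Frac}\,\mathcal{C}=\mathrm{Ob}\,\mathcal{C}$, with double fractions as morphisms, with identities $1_X\backslash 1_X/1_X$, and with the following composition (independent of all choices): if the target of $(b_1,f_1,a_1)$ is the source of $(b_2,f_2,a_2)$, choose an S-denominator $j$ and a T-denominator $q$ with $b_2a_1=jq$, a T-denominator $q'$ and a morphism $f_1'$ with $f_1'q=q'f_1$, and an S-denominator $j'$ and a morphism $f_2'$ with $jf_2'=f_2j'$; then $(b_1\backslash f_1/a_1)(b_2\backslash f_2/a_2)=q'b_1\backslash f_1'f_2'/a_2j'$. A localisation of $\mathcal{C}$ with respect to $D\subseteq\mathrm{Mor}\,\mathcal{C}$ is a category $\mathcal{L}$ with a functor $L\colon\mathcal{C}\to\mathcal{L}$ such that: (Inv) $Ld$ is invertible for $d\in D$; (1-uni)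 every functor $F\colon\mathcal{C}\to\mathcal{D}$ with $Fd$ invertible for all $d\in D$ factors as $F=\hat F\circ L$ for a unique functor $\hat F\colon\mathcal{L}\to\mathcal{D}$; (2-uni) for two such functors $F,G\colon\mathcal{C}\to\mathcal{D}$ and a natural transformation $\alpha\colon F\to G$ there is a unique natural transformation $\hat\alpha\colon\hat F\to\hat G$ with $\hat\alpha_{LX}=\alpha_X$ for all $X\in\mathrm{Ob}\,\mathcal{C}$. *)

theory Defs
  imports Main
begin

section \<open>Categories, functors, natural transformations\<close>

text \<open>
  Composition is written diagrammatically: \<open>f \<cdot> g\<close> is defined if the target of \<open>f\<close> is the
  source of \<open>g\<close>. The operations of the records are total functions; outside the sets of objects
  and morphisms (resp. of composable pairs) their values are irrelevant.
\<close>

record ('o, 'm) category =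
  Ob :: "'o set"
  Mor :: "'m set"
  src :: "'m \<Rightarrow> 'o"
  tgt :: "'m \<Rightarrow> 'o"
  ident :: "'o \<Rightarrow> 'm"
  cmp :: "'m \<Rightarrow> 'm \<Rightarrow> 'm"  (infixl \<open>\<cdot>\<index>\<close> 70)

definition hom :: "('o, 'm, 'z) category_scheme \<Rightarrow> 'o \<Rightarrow> 'o \<Rightarrow> 'm set" where
  "hom C X Y = {f \<in> Mor C. src C f = X \<and> tgt C f = Y}"

definition composable :: "('o, 'm, 'z) category_scheme \<Rightarrow> 'm \<Rightarrow> 'm \<Rightarrow> bool" where
  "composable C f g \<longleftrightarrow> f \<in> Mor C \<and> g \<in> Mor C \<and> tgt C f = src C g"

locale category =
  fixes C :: "('o, 'm, 'z) category_scheme" (structure)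
  assumes src_Ob: "f \<in> Mor C \<Longrightarrow> src C f \<in> Ob C"
    and tgt_Ob: "f \<in> Mor C \<Longrightarrow> tgt C f \<in> Ob C"
    and ident_hom: "X \<in> Ob C \<Longrightarrow> ident C X \<in> hom C X X"
    and cmp_hom: "composable C f g \<Longrightarrow> f \<cdot> g \<in> hom C (src C f) (tgt C g)"
    and ident_left: "f \<in> Mor C \<Longrightarrow> ident C (src C f) \<cdot> f = f"
    and ident_right: "f \<in> Mor C \<Longrightarrow> f \<cdot> ident C (tgt C f) = f"
    and cmp_assoc: "\<lbrakk>composable C f g; composable C g h\<rbrakk> \<Longrightarrow> (f \<cdot> g) \<cdot> h = f \<cdot> (g \<cdot> h)"

text \<open>\<open>commutes C f g h k\<close>: both composites are defined and \<open>f \<cdot> g = h \<cdot> k\<close>.\<close>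

definition commutes :: "('o, 'm, 'z) category_scheme \<Rightarrow> 'm \<Rightarrow> 'm \<Rightarrow> 'm \<Rightarrow> 'm \<Rightarrow> bool" where
  "commutes C f g h k \<longleftrightarrow>
     composable C f g \<and> composable C h k \<and> f \<cdot>\<^bsub>C\<^esub> g = h \<cdot>\<^bsub>C\<^esub> k"

definition is_inverse :: "('o, 'm, 'z) category_scheme \<Rightarrow> 'm \<Rightarrow> 'm \<Rightarrow> bool" where
  "is_inverse C f g \<longleftrightarrow> composable C f g \<and> composable C g f \<and>
     f \<cdot>\<^bsub>C\<^esub> g = ident C (src C f) \<and> g \<cdot>\<^bsub>C\<^esub> f = ident C (tgt C f)"

definition invertible :: "('o, 'm, 'z) category_scheme \<Rightarrow> 'm \<Rightarrow> bool" where
  "invertible C f \<longleftrightarrow> (\<exists>g. is_inverse C f g)"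

definition inv_mor :: "('o, 'm, 'z) category_scheme \<Rightarrow> 'm \<Rightarrow> 'm" where
  "inv_mor C f = (THE g. is_inverse C f g)"

record ('o, 'm, 'p, 'n) cat_functor =
  obj :: "'o \<Rightarrow> 'p"
  mor :: "'m \<Rightarrow> 'n"

definition is_functor ::
    "('o, 'm, 'z) category_scheme \<Rightarrow> ('p, 'n, 'y) category_scheme \<Rightarrow> ('o, 'm, 'p, 'n) cat_functor \<Rightarrow> bool"
  where
  "is_functor C D F \<longleftrightarrow>
     category C \<and> category D \<and>
     (\<forall>X \<in> Ob C. obj F X \<in> Ob D) \<and>
     (\<forall>f \<in> Mor C. mor F f \<in> hom D (obj F (src C f)) (obj F (tgt C f))) \<and>
     (\<forall>X \<in> Ob C. mor F (ident C X) = ident D (obj F X)) \<and>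
     (\<forall>f g. composable C f g \<longrightarrow> mor F (f \<cdot>\<^bsub>C\<^esub> g) = mor F f \<cdot>\<^bsub>D\<^esub> mor F g)"

text \<open>Equality of functors with source category \<open>C\<close>: only the values on \<open>C\<close> count.\<close>

definition functor_eq ::
    "('o, 'm, 'z) category_scheme \<Rightarrow> ('o, 'm, 'p, 'n) cat_functor \<Rightarrow> ('o, 'm, 'p, 'n) cat_functor \<Rightarrow> bool"
  where
  "functor_eq C F G \<longleftrightarrow>
     (\<forall>X \<in> Ob C. obj F X = obj G X) \<and> (\<forall>f \<in> Mor C. mor F f = mor G f)"

text \<open>\<open>functor_comp G F\<close> is \<open>G \<circ> F\<close> (functors are composed in the traditional order).\<close>

definition functor_comp ::
    "('p, 'n, 'q, 'r) cat_functor \<Rightarrow> ('o, 'm, 'p, 'n) cat_functor \<Rightarrow> ('o, 'm, 'q, 'r) cat_functor"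
  where
  "functor_comp G F = \<lparr>obj = obj G \<circ> obj F, mor = mor G \<circ> mor F\<rparr>"

definition nat_trans ::
    "('o, 'm, 'z) category_scheme \<Rightarrow> ('p, 'n, 'y) category_scheme \<Rightarrow>
     ('o, 'm, 'p, 'n) cat_functor \<Rightarrow> ('o, 'm, 'p, 'n) cat_functor \<Rightarrow> ('o \<Rightarrow> 'n) \<Rightarrow> bool"
  where
  "nat_trans C D F G \<alpha> \<longleftrightarrow>
     is_functor C D F \<and> is_functor C D G \<and>
     (\<forall>X \<in> Ob C. \<alpha> X \<in> hom D (obj F X) (obj G X)) \<and>
     (\<forall>f \<in> Mor C. mor F f \<cdot>\<^bsub>D\<^esub> \<alpha> (tgt C f) = \<alpha> (src C f) \<cdot>\<^bsub>D\<^esub> mor G f)"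

section \<open>Localisations\<close>

definition inverts ::
    "'m set \<Rightarrow> ('p, 'n, 'y) category_scheme \<Rightarrow> ('o, 'm, 'p, 'n) cat_functor \<Rightarrow> bool" where
  "inverts S D F \<longleftrightarrow> (\<forall>d \<in> S. invertible D (mor F d))"

text \<open>
  The category \<open>L\<close> with the functor \<open>loc\<close> is a localisation of \<open>C\<close> with respect to \<open>S\<close>.
  HOL has no quantification over types inside a formula, so the types of objects and morphisms of
  the test categories \<open>D\<close> are a parameter (the first argument); in a theorem they are to be left
  as type variables, which makes the theorem range over all test categories.
\<close>

definition is_localisation ::
    "('p \<times> 'n) itself \<Rightarrow> ('o, 'm, 'z) category_scheme \<Rightarrow> 'm set \<Rightarrow>
     ('q, 'r, 'y) category_scheme \<Rightarrow> ('o, 'm, 'q, 'r) cat_functor \<Rightarrow> bool"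
  where
  "is_localisation T C S L loc \<longleftrightarrow>
     S \<subseteq> Mor C \<and> is_functor C L loc \<and>
     \<comment> \<open>(Inv)\<close>
     inverts S L loc \<and>
     \<comment> \<open>(1-uni)\<close>
     (\<forall>(D :: ('p, 'n) category) F. is_functor C D F \<and> inverts S D F \<longrightarrow>
        (\<exists>Fh. is_functor L D Fh \<and> functor_eq C F (functor_comp Fh loc) \<and>
           (\<forall>H. is_functor L D H \<and> functor_eq C F (functor_comp H loc) \<longrightarrow> functor_eq L H Fh))) \<and>
     \<comment> \<open>(2-uni)\<close>
     (\<forall>(D :: ('p, 'n) category) F G Fh Gh \<alpha>.
        is_functor C D F \<and> inverts S D F \<and> is_functor C D G \<and> inverts S D G \<and>
        is_functor L D Fh \<and> functor_eq C F (functor_comp Fh loc) \<and>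
        is_functor L D Gh \<and> functor_eq C G (functor_comp Gh loc) \<and>
        nat_trans C D F G \<alpha> \<longrightarrow>
        (\<exists>\<alpha>h. nat_trans L D Fh Gh \<alpha>h \<and> (\<forall>X \<in> Ob C. \<alpha>h (obj loc X) = \<alpha> X) \<and>
           (\<forall>\<beta>. nat_trans L D Fh Gh \<beta> \<and> (\<forall>X \<in> Ob C. \<beta> (obj loc X) = \<alpha> X) \<longrightarrow>
              (\<forall>Z \<in> Ob L. \<beta> Z = \<alpha>h Z))))"

section \<open>Uni-fractionable categories\<close>

record ('o, 'm) den_category = "('o, 'm) category" +
  Den :: "'m set"

record ('o, 'm) unifrac_category = "('o, 'm) den_category" +
  SDen :: "'m set"
  TDen :: "'m set"

definition multiplicative :: "('o, 'm, 'z) category_scheme \<Rightarrow> 'm set \<Rightarrow> bool" where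
  "multiplicative C S \<longleftrightarrow>
     S \<subseteq> Mor C \<and> (\<forall>X \<in> Ob C. ident C X \<in> S) \<and>
     (\<forall>f g. composable C f g \<and> f \<in> S \<and> g \<in> S \<longrightarrow> f \<cdot>\<^bsub>C\<^esub> g \<in> S)"

definition semi_saturated :: "('o, 'm, 'z) category_scheme \<Rightarrow> 'm set \<Rightarrow> bool" where
  "semi_saturated C S \<longleftrightarrow>
     multiplicative C S \<and>
     (\<forall>f g. composable C f g \<longrightarrow>
        (f \<in> S \<and> g \<in> S \<longrightarrow> f \<cdot>\<^bsub>C\<^esub> g \<in> S) \<and>
        (f \<in> S \<and> f \<cdot>\<^bsub>C\<^esub> g \<in> S \<longrightarrow> g \<in> S) \<and>
        (g \<in> S \<and> f \<cdot>\<^bsub>C\<^esub> g \<in> S \<longrightarrow> f \<in> S))"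

text \<open>\<open>weak_pushout C i f i' f'\<close>: the square \<open>i \<cdot> f' = f \<cdot> i'\<close> is a weak pushout of \<open>i\<close> and \<open>f\<close>.\<close>

definition weak_pushout :: "('o, 'm, 'z) category_scheme \<Rightarrow> 'm \<Rightarrow> 'm \<Rightarrow> 'm \<Rightarrow> 'm \<Rightarrow> bool" where
  "weak_pushout C i f i' f' \<longleftrightarrow>
     commutes C i f' f i' \<and>
     (\<forall>h k. commutes C i h f k \<longrightarrow>
        (\<exists>u. composable C f' u \<and> f' \<cdot>\<^bsub>C\<^esub> u = h \<and> i' \<cdot>\<^bsub>C\<^esub> u = k))"

text \<open>\<open>weak_pullback C p f p' f'\<close>: the square \<open>f' \<cdot> p = p' \<cdot> f\<close> is a weak pullback of \<open>p\<close> and \<open>f\<close>.\<close>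

definition weak_pullback :: "('o, 'm, 'z) category_scheme \<Rightarrow> 'm \<Rightarrow> 'm \<Rightarrow> 'm \<Rightarrow> 'm \<Rightarrow> bool" where
  "weak_pullback C p f p' f' \<longleftrightarrow>
     commutes C f' p p' f \<and>
     (\<forall>h k. commutes C h p k f \<longrightarrow>
        (\<exists>u. composable C u f' \<and> u \<cdot>\<^bsub>C\<^esub> f' = h \<and> u \<cdot>\<^bsub>C\<^esub> p' = k))"

locale uni_fractionable = category C
  for C :: "('o, 'm, 'z) unifrac_category_scheme" (structure) +
  assumes Den_semi_saturated: "semi_saturated C (Den C)"
    and SDen_multiplicative: "multiplicative C (SDen C)"
    and TDen_multiplicative: "multiplicative C (TDen C)"
    and SDen_Den: "SDen C \<subseteq> Den C"
    and TDen_Den: "TDen C \<subseteq> Den C"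
    and WU_SDen: "\<lbrakk>i \<in> SDen C; f \<in> Mor C; src C f = src C i\<rbrakk> \<Longrightarrow>
           \<exists>i' f'. i' \<in> SDen C \<and> weak_pushout C i f i' f'"
    and WU_TDen: "\<lbrakk>p \<in> TDen C; f \<in> Mor C; tgt C f = tgt C p\<rbrakk> \<Longrightarrow>
           \<exists>p' f'. p' \<in> TDen C \<and> weak_pullback C p f p' f'"
    and Fac: "d \<in> Den C \<Longrightarrow>
           \<exists>i p. i \<in> SDen C \<and> p \<in> TDen C \<and> composable C i p \<and> d = i \<cdot> p"

section \<open>The fraction category\<close>

text \<open>A 3-arrow \<open>(b, f, a)\<close> points from the target of \<open>b\<close> to the source of \<open>a\<close>.\<close>

definition three_arrows :: "('o, 'm, 'z) den_category_scheme \<Rightarrow> ('m \<times> 'm \<times> 'm) set" where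
  "three_arrows C = {(b, f, a). b \<in> Den C \<and> f \<in> Mor C \<and> a \<in> Den C \<and>
     src C b = src C f \<and> tgt C f = tgt C a}"

definition normal_three_arrows :: "('o, 'm, 'z) unifrac_category_scheme \<Rightarrow> ('m \<times> 'm \<times> 'm) set" where
  "normal_three_arrows C = {(b, f, a) \<in> three_arrows C. b \<in> TDen C \<and> a \<in> SDen C}"

inductive_set fraction_eq ::
    "('o, 'm, 'z) den_category_scheme \<Rightarrow> (('m \<times> 'm \<times> 'm) \<times> ('m \<times> 'm \<times> 'm)) set"
  for C :: "('o, 'm, 'z) den_category_scheme" where
  expand_right: "\<lbrakk>(b, f, a) \<in> three_arrows C; composable C a c; a \<cdot>\<^bsub>C\<^esub> c \<in> Den C\<rbrakk> \<Longrightarrow>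
     ((b, f, a), (b, f \<cdot>\<^bsub>C\<^esub> c, a \<cdot>\<^bsub>C\<^esub> c)) \<in> fraction_eq C"
| expand_left: "\<lbrakk>(b, f, a) \<in> three_arrows C; composable C c b; c \<cdot>\<^bsub>C\<^esub> b \<in> Den C\<rbrakk> \<Longrightarrow>
     ((b, f, a), (c \<cdot>\<^bsub>C\<^esub> b, c \<cdot>\<^bsub>C\<^esub> f, a)) \<in> fraction_eq C"
| refl: "t \<in> three_arrows C \<Longrightarrow> (t, t) \<in> fraction_eq C"
| sym: "(s, t) \<in> fraction_eq C \<Longrightarrow> (t, s) \<in> fraction_eq C"
| trans: "\<lbrakk>(s, t) \<in> fraction_eq C; (t, u) \<in> fraction_eq C\<rbrakk> \<Longrightarrow> (s, u) \<in> fraction_eq C"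

text \<open>The double fraction \<open>dfrac C b f a\<close> is the equivalence class of the 3-arrow \<open>(b, f, a)\<close>.\<close>

definition dfrac :: "('o, 'm, 'z) den_category_scheme \<Rightarrow> 'm \<Rightarrow> 'm \<Rightarrow> 'm \<Rightarrow> ('m \<times> 'm \<times> 'm) set" where
  "dfrac C b f a = fraction_eq C `` {(b, f, a)}"

text \<open>
  \<open>is_frac_composite C x y z\<close>: the double fraction \<open>z\<close> arises from \<open>x\<close> and \<open>y\<close> by some choice of
  representatives and of the auxiliary S-denominators, T-denominators and morphisms.
\<close>

definition is_frac_composite ::
    "('o, 'm, 'z) unifrac_category_scheme \<Rightarrow>
     ('m \<times> 'm \<times> 'm) set \<Rightarrow> ('m \<times> 'm \<times> 'm) set \<Rightarrow> ('m \<times> 'm \<times> 'm) set \<Rightarrow> bool"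
  where
  "is_frac_composite C x y z \<longleftrightarrow>
     (\<exists>b1 f1 a1 b2 f2 a2 j q q' g1 j' g2.
        (b1, f1, a1) \<in> three_arrows C \<and> x = dfrac C b1 f1 a1 \<and>
        (b2, f2, a2) \<in> three_arrows C \<and> y = dfrac C b2 f2 a2 \<and>
        j \<in> SDen C \<and> q \<in> TDen C \<and> commutes C b2 a1 j q \<and>
        q' \<in> TDen C \<and> commutes C g1 q q' f1 \<and>
        j' \<in> SDen C \<and> commutes C j g2 f2 j' \<and>
        z = dfrac C (q' \<cdot>\<^bsub>C\<^esub> b1) (g1 \<cdot>\<^bsub>C\<^esub> g2) (a2 \<cdot>\<^bsub>C\<^esub> j'))"

definition Frac :: "('o, 'm, 'z) unifrac_category_scheme \<Rightarrow> ('o, ('m \<times> 'm \<times> 'm) set) category" where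
  "Frac C = \<lparr>
     Ob = Ob C,
     Mor = three_arrows C // fraction_eq C,
     src = (\<lambda>x. THE X. \<exists>b f a. (b, f, a) \<in> three_arrows C \<and> x = dfrac C b f a \<and> X = tgt C b),
     tgt = (\<lambda>x. THE Y. \<exists>b f a. (b, f, a) \<in> three_arrows C \<and> x = dfrac C b f a \<and> Y = src C a),
     ident = (\<lambda>X. dfrac C (ident C X) (ident C X) (ident C X)),
     cmp = (\<lambda>x y. THE z. is_frac_composite C x y z)\<rparr>"

definition loc :: "('o, 'm, 'z) unifrac_category_scheme \<Rightarrow>
    ('o, 'm, 'o, ('m \<times> 'm \<times> 'm) set) cat_functor" where
  "loc C = \<lparr>obj = (\<lambda>X. X), mor = (\<lambda>f. dfrac C (ident C (src C f)) f (ident C (tgt C f)))\<rparr>"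

end

theory Submission
  imports Defs
begin

text \<open>
  Any two choices in the composition rule become comparable after refining the denominators
  \<open>d, e\<close> to an S- and a T-denominator, and a choice for an expanded 3-arrow is a choice for the
  original one with the same result. Hence composition is well defined even for arbitrary
  denominators, and associativity reduces to factoring one square of denominators. Since the
  class of \<open>(b, f, a)\<close> is \<open>loc(b)\<inverse> loc(f) loc(a)\<inverse>\<close>, the universal properties are forced.

  For part (c), call a morphism of 3-arrows one over the identities if it fixes both ends. Fraction
  equality is connectedness under such morphisms. They factor into an S-morphism followed by a
  T-morphism, T-morphisms can be pulled back and S-morphisms pushed out, so any path shortens to a
  single zigzag \<open>s \<leftarrow> s' \<rightarrow> s'' \<leftarrow> t\<close> whose first map is T and whose last map is S. This is
  the required diagram when the vertical 3-arrows are identities; the general case is reduced to it.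
\<close>

text \<open>Weak squares induce morphisms without uniqueness. Semi-saturation makes up for this: an
  induced morphism that compares two denominators is a denominator by two out of three, hence an
  admissible expansion of a 3-arrow, and so different choices differ only by expansions. Composition
  is treated for arbitrary denominators from the outset because the grid of part (c) is itself a
  pair of such choices, one for each composite, and its inner rows contain mere denominators. The
  shortening of paths depends on the asymmetric shape of the zigzag. A forward step at its right end
  is absorbed by pushing out the S-leg; a backward step enlarges that leg, whose T-part is then
  passed through the middle map to the left leg. The reduction of the general case to this one works
  because both composites are represented by 3-arrows whose left denominators end in
  \<open>p1\<close> and whose right denominators begin with \<open>i2\<close>. These factors cancel,
  since \<open>loc\<close> inverts them.\<close>

context category
begin

lemma cmp_Mor [simp]: "\<lbrakk>f \<in> Mor C; g \<in> Mor C; tgt C f = src C g\<rbrakk> \<Longrightarrow> f \<cdot> g \<in> Mor C"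
  and src_cmp [simp]: "\<lbrakk>f \<in> Mor C; g \<in> Mor C; tgt C f = src C g\<rbrakk> \<Longrightarrow> src C (f \<cdot> g) = src C f"
  and tgt_cmp [simp]: "\<lbrakk>f \<in> Mor C; g \<in> Mor C; tgt C f = src C g\<rbrakk> \<Longrightarrow> tgt C (f \<cdot> g) = tgt C g"
  using cmp_hom[of f g] by (auto simp: composable_def hom_def)

lemma assoc [simp]:
  "\<lbrakk>f \<in> Mor C; g \<in> Mor C; h \<in> Mor C; tgt C f = src C g; tgt C g = src C h\<rbrakk>
    \<Longrightarrow> (f \<cdot> g) \<cdot> h = f \<cdot> (g \<cdot> h)"
  by (rule cmp_assoc) (auto simp: composable_def)

lemma ident_Mor [simp]: "X \<in> Ob C \<Longrightarrow> ident C X \<in> Mor C"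
  and src_ident [simp]: "X \<in> Ob C \<Longrightarrow> src C (ident C X) = X"
  and tgt_ident [simp]: "X \<in> Ob C \<Longrightarrow> tgt C (ident C X) = X"
  using ident_hom[of X] by (auto simp: hom_def)

lemma ident_cmp [simp]: "\<lbrakk>f \<in> Mor C; src C f = X\<rbrakk> \<Longrightarrow> ident C X \<cdot> f = f"
  and cmp_ident [simp]: "\<lbrakk>f \<in> Mor C; tgt C f = X\<rbrakk> \<Longrightarrow> f \<cdot> ident C X = f"
  using ident_left ident_right by auto

declare src_Ob [simp] tgt_Ob [simp]

text \<open>\<open>assoc\<close> nests composites to the right, where \<open>f \<cdot> g\<close> is
  no longer a subterm of \<open>f \<cdot> (g \<cdot> x)\<close>. This is the form in which a
  commuting square rewrites inside a longer composite.\<close>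

lemma cmp_eq_extend:
  "\<lbrakk>f \<cdot> g = h \<cdot> k; f \<in> Mor C; g \<in> Mor C; h \<in> Mor C; k \<in> Mor C; x \<in> Mor C;
    tgt C f = src C g; tgt C h = src C k; src C x = tgt C g; tgt C k = tgt C g\<rbrakk>
    \<Longrightarrow> f \<cdot> (g \<cdot> x) = h \<cdot> (k \<cdot> x)"
  by (metis assoc)

end

lemma commutes_iff:
  "commutes C f g h k \<longleftrightarrow> f \<in> Mor C \<and> g \<in> Mor C \<and> h \<in> Mor C \<and> k \<in> Mor C \<and>
     tgt C f = src C g \<and> tgt C h = src C k \<and> f \<cdot>\<^bsub>C\<^esub> g = h \<cdot>\<^bsub>C\<^esub> k"
  by (auto simp: commutes_def composable_def)

text \<open>\<open>commutes\<close> records only that the two composites are defined; the outer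
  corners of the square agree because equal morphisms have equal ends.\<close>

lemma (in category) commutesD:
  assumes "commutes C f g h k"
  shows "src C h = src C f" and "tgt C k = tgt C g"
  using assms unfolding commutes_iff by (metis src_cmp, metis tgt_cmp)

lemma three_arrows_iff [simp]:
  "(b, f, a) \<in> three_arrows C \<longleftrightarrow>
     b \<in> Den C \<and> f \<in> Mor C \<and> a \<in> Den C \<and> src C b = src C f \<and> tgt C f = tgt C a"
  by (simp add: three_arrows_def)

section \<open>Closure properties of denominators, factorisations and weak squares\<close>

context uni_fractionable
begin

lemma Den_Mor [simp]: "d \<in> Den C \<Longrightarrow> d \<in> Mor C"
  and ident_Den [simp]: "X \<in> Ob C \<Longrightarrow> ident C X \<in> Den C"
  and Den_cmp [simp]: "\<lbrakk>d \<in> Den C; e \<in> Den C; tgt C d = src C e\<rbrakk> \<Longrightarrow> d \<cdot> e \<in> Den C"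
  using Den_semi_saturated unfolding semi_saturated_def multiplicative_def composable_def
  by blast+

text \<open>The two cancellation cases of semi-saturation. They make denominators of morphisms
  induced by weak squares and of the morphisms \<open>c\<close> in expansions of 3-arrows.\<close>

lemma Den_cancel_left:
    "\<lbrakk>d \<in> Den C; d \<cdot> f \<in> Den C; f \<in> Mor C; tgt C d = src C f\<rbrakk> \<Longrightarrow> f \<in> Den C"
  and Den_cancel_right:
    "\<lbrakk>d \<in> Den C; f \<cdot> d \<in> Den C; f \<in> Mor C; tgt C f = src C d\<rbrakk> \<Longrightarrow> f \<in> Den C"
  using Den_semi_saturated unfolding semi_saturated_def composable_def
  by (meson Den_Mor)+

lemma SDen_imp_Den [simp]: "i \<in> SDen C \<Longrightarrow> i \<in> Den C"
  and ident_SDen [simp]: "X \<in> Ob C \<Longrightarrow> ident C X \<in> SDen C"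
  and SDen_cmp [simp]: "\<lbrakk>i \<in> SDen C; j \<in> SDen C; tgt C i = src C j\<rbrakk> \<Longrightarrow> i \<cdot> j \<in> SDen C"
  using SDen_multiplicative SDen_Den unfolding multiplicative_def composable_def by blast+

lemma TDen_imp_Den [simp]: "p \<in> TDen C \<Longrightarrow> p \<in> Den C"
  and ident_TDen [simp]: "X \<in> Ob C \<Longrightarrow> ident C X \<in> TDen C"
  and TDen_cmp [simp]: "\<lbrakk>p \<in> TDen C; q \<in> TDen C; tgt C p = src C q\<rbrakk> \<Longrightarrow> p \<cdot> q \<in> TDen C"
  using TDen_multiplicative TDen_Den unfolding multiplicative_def composable_def by blast+

lemma Den_factor:
  assumes "d \<in> Den C" "src C d = X" "tgt C d = Y"
  obtains i p where "i \<in> SDen C" "p \<in> TDen C" "src C i = X" "tgt C i = src C p"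
    "tgt C p = Y" "i \<cdot> p = d"
  using Fac[OF assms(1)] assms(2,3) by (auto simp: composable_def)

lemma SDen_pushout:
  assumes "i \<in> SDen C" "f \<in> Mor C" "src C f = src C i"
  obtains i' f' where "i' \<in> SDen C" "f' \<in> Mor C" "src C f' = tgt C i" "src C i' = tgt C f"
    "tgt C f' = tgt C i'" "i \<cdot> f' = f \<cdot> i'"
    "\<And>h k. \<lbrakk>h \<in> Mor C; k \<in> Mor C; src C h = tgt C i; src C k = tgt C f; i \<cdot> h = f \<cdot> k\<rbrakk> \<Longrightarrow>
       \<exists>u. u \<in> Mor C \<and> src C u = tgt C i' \<and> tgt C u = tgt C h \<and> f' \<cdot> u = h \<and> i' \<cdot> u = k"
proof -
  obtain i' f' where i': "i' \<in> SDen C" and po: "weak_pushout C i f i' f'"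
    using WU_SDen assms by blast
  have c: "commutes C i f' f i'" using po by (simp add: weak_pushout_def)
  show thesis
  proof (rule that)
    fix h k
    assume "h \<in> Mor C" "k \<in> Mor C" "src C h = tgt C i" "src C k = tgt C f" "i \<cdot> h = f \<cdot> k"
    then have "commutes C i h f k" using assms by (auto simp: commutes_iff)
    then obtain u where u: "composable C f' u" "f' \<cdot> u = h" "i' \<cdot> u = k"
      using po unfolding weak_pushout_def by blast
    then show "\<exists>u. u \<in> Mor C \<and> src C u = tgt C i' \<and> tgt C u = tgt C h \<and> f' \<cdot> u = h \<and> i' \<cdot> u = k"
      using commutesD[OF c] by (intro exI[of _ u]) (auto simp: composable_def)
  qed (use i' c commutesD[OF c] in \<open>auto simp: commutes_iff\<close>)
qed

lemma TDen_pullback: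
  assumes "p \<in> TDen C" "f \<in> Mor C" "tgt C f = tgt C p"
  obtains p' f' where "p' \<in> TDen C" "f' \<in> Mor C" "tgt C f' = src C p" "tgt C p' = src C f"
    "src C f' = src C p'" "f' \<cdot> p = p' \<cdot> f"
    "\<And>h k. \<lbrakk>h \<in> Mor C; k \<in> Mor C; tgt C h = src C p; tgt C k = src C f; h \<cdot> p = k \<cdot> f\<rbrakk> \<Longrightarrow>
       \<exists>u. u \<in> Mor C \<and> tgt C u = src C p' \<and> src C u = src C h \<and> u \<cdot> f' = h \<and> u \<cdot> p' = k"
proof -
  obtain p' f' where p': "p' \<in> TDen C" and pb: "weak_pullback C p f p' f'"
    using WU_TDen assms by blast
  have c: "commutes C f' p p' f" using pb by (simp add: weak_pullback_def)
  show thesis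
  proof (rule that)
    fix h k
    assume "h \<in> Mor C" "k \<in> Mor C" "tgt C h = src C p" "tgt C k = src C f" "h \<cdot> p = k \<cdot> f"
    then have "commutes C h p k f" using assms by (auto simp: commutes_iff)
    then obtain u where u: "composable C u f'" "u \<cdot> f' = h" "u \<cdot> p' = k"
      using pb unfolding weak_pullback_def by blast
    then show "\<exists>u. u \<in> Mor C \<and> tgt C u = src C p' \<and> src C u = src C h \<and> u \<cdot> f' = h \<and> u \<cdot> p' = k"
      using commutesD[OF c] by (intro exI[of _ u]) (auto simp: composable_def)
  qed (use p' c commutesD[OF c] in \<open>auto simp: commutes_iff\<close>)
qed

subsection \<open>Fraction equality\<close>

text \<open>An expansion changes only the two inner objects of a 3-arrow, which is why source and
  target of a double fraction are well defined.\<close>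

lemma fraction_eq_dest:
  "(s, t) \<in> fraction_eq C \<Longrightarrow> s \<in> three_arrows C \<and> t \<in> three_arrows C \<and>
     tgt C (fst s) = tgt C (fst t) \<and> src C (snd (snd s)) = src C (snd (snd t))"
  by (induction rule: fraction_eq.induct) (auto simp: composable_def)

lemma equiv_fraction_eq: "equiv (three_arrows C) (fraction_eq C)"
  by (rule equivI)
    (auto simp: refl_on_def sym_def trans_def intro: fraction_eq.intros dest: fraction_eq_dest)

lemma dfrac_eq_iff:
  "\<lbrakk>(b, f, a) \<in> three_arrows C; (b', f', a') \<in> three_arrows C\<rbrakk> \<Longrightarrow>
     dfrac C b f a = dfrac C b' f' a' \<longleftrightarrow> ((b, f, a), (b', f', a')) \<in> fraction_eq C"
  unfolding dfrac_def by (rule eq_equiv_class_iff[OF equiv_fraction_eq])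

lemma dfrac_expand_right:
  assumes "(b, f, a) \<in> three_arrows C" "c \<in> Mor C" "src C c = tgt C a" "a \<cdot> c \<in> Den C"
  shows "dfrac C b (f \<cdot> c) (a \<cdot> c) = dfrac C b f a"
  using assms by (subst dfrac_eq_iff)
    (auto intro!: fraction_eq.sym[OF fraction_eq.expand_right] simp: composable_def)

lemma dfrac_expand_left:
  assumes "(b, f, a) \<in> three_arrows C" "c \<in> Mor C" "tgt C c = src C b" "c \<cdot> b \<in> Den C"
  shows "dfrac C (c \<cdot> b) (c \<cdot> f) a = dfrac C b f a"
  using assms by (subst dfrac_eq_iff)
    (auto intro!: fraction_eq.sym[OF fraction_eq.expand_left] simp: composable_def)

lemma dfrac_endpoints:
  assumes "dfrac C b f a = dfrac C b' f' a'"
    "(b, f, a) \<in> three_arrows C" "(b', f', a') \<in> three_arrows C"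
  shows "tgt C b = tgt C b'" "src C a = src C a'"
  using assms fraction_eq_dest dfrac_eq_iff by fastforce+

subsection \<open>Composition of double fractions\<close>

text \<open>All four denominators are arbitrary, as in part (a). The choices in
  \<open>is_frac_composite\<close> are the case with \<open>d\<close>, \<open>d'\<close> in
  \<open>SDen C\<close> and \<open>e\<close>, \<open>e'\<close> in \<open>TDen C\<close>, so one
  uniqueness result serves both rules.\<close>

definition composite_choice where
  "composite_choice b1 f1 a1 b2 f2 a2 d d' e e' g1 g2 \<longleftrightarrow>
     (b1, f1, a1) \<in> three_arrows C \<and> (b2, f2, a2) \<in> three_arrows C \<and>
     d \<in> Den C \<and> d' \<in> Den C \<and> e \<in> Den C \<and> e' \<in> Den C \<and>
     commutes C b2 a1 d e \<and> commutes C g1 e e' f1 \<and> commutes C d g2 f2 d'"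

text \<open>Facts 1 to 26 are typing information, facts 27 to 29 are the three squares. Many later
  steps pass only the first range to the simplifier and apply the squares separately.\<close>

lemma composite_choiceD:
  assumes "composite_choice b1 f1 a1 b2 f2 a2 d d' e e' g1 g2"
  shows "b1 \<in> Den C" "f1 \<in> Mor C" "a1 \<in> Den C" "b2 \<in> Den C" "f2 \<in> Mor C" "a2 \<in> Den C"
    "d \<in> Den C" "d' \<in> Den C" "e \<in> Den C" "e' \<in> Den C" "g1 \<in> Mor C" "g2 \<in> Mor C"
    "src C f1 = src C b1" "tgt C f1 = tgt C a1" "src C f2 = src C b2" "tgt C f2 = tgt C a2"
    "src C a1 = tgt C b2" "src C d = src C b2" "src C e = tgt C d" "tgt C e = tgt C a1"
    "src C g1 = src C e'" "tgt C g1 = tgt C d" "tgt C e' = src C b1"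
    "src C g2 = tgt C d" "tgt C g2 = tgt C d'" "src C d' = tgt C a2"
    "b2 \<cdot> a1 = d \<cdot> e" "g1 \<cdot> e = e' \<cdot> f1" "d \<cdot> g2 = f2 \<cdot> d'"
proof -
  have c: "commutes C b2 a1 d e" "commutes C g1 e e' f1" "commutes C d g2 f2 d'"
    using assms by (simp_all add: composite_choice_def)
  note D = c[THEN commutesD(1)] c[THEN commutesD(2)]
  show "b1 \<in> Den C" "f1 \<in> Mor C" "a1 \<in> Den C" "b2 \<in> Den C" "f2 \<in> Mor C" "a2 \<in> Den C"
    "d \<in> Den C" "d' \<in> Den C" "e \<in> Den C" "e' \<in> Den C" "g1 \<in> Mor C" "g2 \<in> Mor C"
    "src C f1 = src C b1" "tgt C f1 = tgt C a1" "src C f2 = src C b2" "tgt C f2 = tgt C a2"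
    "src C a1 = tgt C b2" "src C d = src C b2" "src C e = tgt C d" "tgt C e = tgt C a1"
    "src C g1 = src C e'" "tgt C g1 = tgt C d" "tgt C e' = src C b1"
    "src C g2 = tgt C d" "tgt C g2 = tgt C d'" "src C d' = tgt C a2"
    "b2 \<cdot> a1 = d \<cdot> e" "g1 \<cdot> e = e' \<cdot> f1" "d \<cdot> g2 = f2 \<cdot> d'"
    using assms D by (auto simp: composite_choice_def commutes_iff)
qed

lemma composite_choiceI:
  assumes "b1 \<in> Den C" "f1 \<in> Mor C" "a1 \<in> Den C" "b2 \<in> Den C" "f2 \<in> Mor C" "a2 \<in> Den C"
    "d \<in> Den C" "d' \<in> Den C" "e \<in> Den C" "e' \<in> Den C" "g1 \<in> Mor C" "g2 \<in> Mor C"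
    "src C f1 = src C b1" "tgt C f1 = tgt C a1" "src C f2 = src C b2" "tgt C f2 = tgt C a2"
    "src C a1 = tgt C b2" "src C e = tgt C d"
    "tgt C g1 = tgt C d" "tgt C e' = src C b1" "src C g2 = tgt C d" "src C d' = tgt C a2"
    "b2 \<cdot> a1 = d \<cdot> e" "g1 \<cdot> e = e' \<cdot> f1" "d \<cdot> g2 = f2 \<cdot> d'"
  shows "composite_choice b1 f1 a1 b2 f2 a2 d d' e e' g1 g2"
  using assms by (simp add: composite_choice_def commutes_iff)

lemma composite_choice_exists:
  assumes "(b1, f1, a1) \<in> three_arrows C" "(b2, f2, a2) \<in> three_arrows C" "src C a1 = tgt C b2"
  obtains j j' q q' g1 g2 where "composite_choice b1 f1 a1 b2 f2 a2 j j' q q' g1 g2"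
    "j \<in> SDen C" "j' \<in> SDen C" "q \<in> TDen C" "q' \<in> TDen C"
proof -
  obtain j q where j: "j \<in> SDen C" "q \<in> TDen C" "src C j = src C b2"
      "tgt C j = src C q" "tgt C q = tgt C a1" "j \<cdot> q = b2 \<cdot> a1"
    by (rule Den_factor[of "b2 \<cdot> a1" "src C b2" "tgt C a1"]) (use assms in auto)
  obtain q' g1 where q': "q' \<in> TDen C" "g1 \<in> Mor C" "tgt C g1 = src C q" "tgt C q' = src C f1"
      "g1 \<cdot> q = q' \<cdot> f1"
    by (rule TDen_pullback[of q f1]) (use assms j in auto)
  obtain j' g2 where j': "j' \<in> SDen C" "g2 \<in> Mor C" "src C g2 = tgt C j" "src C j' = tgt C f2"
      "j \<cdot> g2 = f2 \<cdot> j'"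
    by (rule SDen_pushout[of j f2]) (use assms j in auto)
  show thesis
    by (rule that[of j j' q q' g1 g2], rule composite_choiceI) (use assms j q' j' in auto)
qed

text \<open>Split \<open>d = i \<cdot> p\<close> and \<open>p \<cdot> e = k \<cdot> q\<close>; then
  \<open>(i \<cdot> k) \<cdot> q\<close> is a factorisation of \<open>b2 \<cdot> a1\<close> of the
  desired kind. The squares are adapted by pulling \<open>p\<close> back along \<open>g1\<close> and
  pushing \<open>k\<close> out along \<open>p \<cdot> g2\<close>. Only the middle factorisation
  becomes normal; the outer denominators \<open>p' \<cdot> e'\<close> and
  \<open>d' \<cdot> k'\<close> are just denominators.\<close>

lemma composite_choice_normalise:
  assumes "composite_choice b1 f1 a1 b2 f2 a2 d d' e e' g1 g2"
  obtains j j' q q' h1 h2 where "composite_choice b1 f1 a1 b2 f2 a2 j j' q q' h1 h2"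
    "j \<in> SDen C" "q \<in> TDen C"
    "dfrac C (q' \<cdot> b1) (h1 \<cdot> h2) (a2 \<cdot> j') = dfrac C (e' \<cdot> b1) (g1 \<cdot> g2) (a2 \<cdot> d')"
proof -
  note A = composite_choiceD[OF assms]
  obtain i p where ip: "i \<in> SDen C" "p \<in> TDen C" "src C i = src C b2" "tgt C i = src C p"
    "tgt C p = tgt C d" "i \<cdot> p = d"
    by (rule Den_factor[of d "src C b2" "tgt C d"]) (auto simp: A)
  obtain k q where kq: "k \<in> SDen C" "q \<in> TDen C" "src C k = src C p"
    "tgt C k = src C q" "tgt C q = tgt C a1" "k \<cdot> q = p \<cdot> e"
    by (rule Den_factor[of "p \<cdot> e" "src C p" "tgt C a1"]) (auto simp: A ip)
  obtain p' h where h: "p' \<in> TDen C" "h \<in> Mor C" "tgt C h = src C p" "tgt C p' = src C g1"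
      "src C h = src C p'" "h \<cdot> p = p' \<cdot> g1"
    by (rule TDen_pullback[of p g1]) (auto simp: A ip)
  obtain k' h2 where h2: "k' \<in> SDen C" "h2 \<in> Mor C" "src C h2 = tgt C k" "src C k' = tgt C d'"
      "tgt C h2 = tgt C k'" "k \<cdot> h2 = (p \<cdot> g2) \<cdot> k'"
    by (rule SDen_pushout[of k "p \<cdot> g2"]) (auto simp: A ip kq)
  have e1: "h \<cdot> (k \<cdot> q) = p' \<cdot> (e' \<cdot> f1)"
    unfolding kq(6) by (simp add: cmp_eq_extend[OF h(6)] A ip h)
  have e2: "i \<cdot> (k \<cdot> h2) = f2 \<cdot> (d' \<cdot> k')"
  proof -
    have "i \<cdot> (k \<cdot> h2) = ((i \<cdot> p) \<cdot> g2) \<cdot> k'"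
      unfolding h2(6) using A(1-26) ip(1-5) h2(1-5) by simp
    also have "\<dots> = (f2 \<cdot> d') \<cdot> k'" unfolding ip(6) A by simp
    finally show ?thesis using A(1-26) h2(1-5) by simp
  qed
  have e3: "h \<cdot> (k \<cdot> h2) = p' \<cdot> (g1 \<cdot> (g2 \<cdot> k'))"
    unfolding h2(6) by (simp add: cmp_eq_extend[OF h(6)] A(1-26) ip(1-5) h2(1-5) h(1-5))
  have e4: "b2 \<cdot> a1 = i \<cdot> (k \<cdot> q)"
    unfolding kq(6) A(27) ip(6)[symmetric] using A(1-26) ip(1-5) by simp
  note T = A(1-26) ip(1-5) kq(1-5) h(1-5) h2(1-5)
  have cc: "composite_choice b1 f1 a1 b2 f2 a2 (i \<cdot> k) (d' \<cdot> k') q (p' \<cdot> e') (h \<cdot> k) h2"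
    by (intro composite_choiceI) (simp_all add: T e1 e2 e4)
  \<comment> \<open>The numerator \<open>h k h2\<close> equals \<open>h p g2 k'\<close> and hence
    \<open>p' g1 g2 k'\<close>: the new 3-arrow is the old one expanded by \<open>p'\<close> on the
    left and by \<open>k'\<close> on the right.\<close>
  have "dfrac C ((p' \<cdot> e') \<cdot> b1) ((h \<cdot> k) \<cdot> h2) (a2 \<cdot> (d' \<cdot> k'))
      = dfrac C (p' \<cdot> (e' \<cdot> b1)) (p' \<cdot> ((g1 \<cdot> g2) \<cdot> k')) ((a2 \<cdot> d') \<cdot> k')"
    using T e3 by simp
  also have "\<dots> = dfrac C (e' \<cdot> b1) ((g1 \<cdot> g2) \<cdot> k') ((a2 \<cdot> d') \<cdot> k')"
    by (intro dfrac_expand_left) (simp_all add: T)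
  also have "\<dots> = dfrac C (e' \<cdot> b1) (g1 \<cdot> g2) (a2 \<cdot> d')"
    by (intro dfrac_expand_right) (simp_all add: T)
  finally show thesis using that[OF cc] T by simp
qed

text \<open>Every choice over the factorisation \<open>j\<close>, \<open>q\<close> factors through a
  weak pullback of \<open>q\<close> and a weak pushout of \<open>j\<close> by induced morphisms
  \<open>u\<close> and \<open>v\<close>. By cancellation these are denominators, so the composite is
  an expansion of the one formed from the two weak squares.\<close>

lemma composite_unique_fixed_factor:
  assumes "composite_choice b1 f1 a1 b2 f2 a2 j j1 q q1 g1 g2"
    and "composite_choice b1 f1 a1 b2 f2 a2 j j2 q q2 h1 h2"
    and j: "j \<in> SDen C" and q: "q \<in> TDen C"
  shows "dfrac C (q1 \<cdot> b1) (g1 \<cdot> g2) (a2 \<cdot> j1) = dfrac C (q2 \<cdot> b1) (h1 \<cdot> h2) (a2 \<cdot> j2)"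
proof -
  note A = composite_choiceD[OF assms(1)]
  obtain p0 f0 where p0: "p0 \<in> TDen C" "f0 \<in> Mor C" "tgt C f0 = src C q" "tgt C p0 = src C b1"
      "src C f0 = src C p0" "f0 \<cdot> q = p0 \<cdot> f1"
    and pu: "\<And>h k. \<lbrakk>h \<in> Mor C; k \<in> Mor C; tgt C h = src C q; tgt C k = src C f1; h \<cdot> q = k \<cdot> f1\<rbrakk> \<Longrightarrow>
       \<exists>u. u \<in> Mor C \<and> tgt C u = src C p0 \<and> src C u = src C h \<and> u \<cdot> f0 = h \<and> u \<cdot> p0 = k"
    by (rule TDen_pullback[of q f1]) (auto simp: A q)
  obtain j0 h0 where j0: "j0 \<in> SDen C" "h0 \<in> Mor C" "src C h0 = tgt C j" "src C j0 = tgt C a2"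
      "tgt C h0 = tgt C j0" "j \<cdot> h0 = f2 \<cdot> j0"
    and ju: "\<And>h k. \<lbrakk>h \<in> Mor C; k \<in> Mor C; src C h = tgt C j; src C k = tgt C f2; j \<cdot> h = f2 \<cdot> k\<rbrakk> \<Longrightarrow>
       \<exists>u. u \<in> Mor C \<and> src C u = tgt C j0 \<and> tgt C u = tgt C h \<and> h0 \<cdot> u = h \<and> j0 \<cdot> u = k"
    by (rule SDen_pushout[of j f2]) (auto simp: A j)
  have canonical: "dfrac C (q' \<cdot> b1) (k1 \<cdot> k2) (a2 \<cdot> j') = dfrac C (p0 \<cdot> b1) (f0 \<cdot> h0) (a2 \<cdot> j0)"
    if "composite_choice b1 f1 a1 b2 f2 a2 j j' q q' k1 k2" for j' q' k1 k2
  proof -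
    note B = composite_choiceD[OF that]
    obtain u where u: "u \<in> Mor C" "tgt C u = src C p0" "src C u = src C q'"
        "u \<cdot> f0 = k1" "u \<cdot> p0 = q'"
      using pu[of k1 q'] B by auto
    obtain v where v: "v \<in> Mor C" "src C v = tgt C j0" "tgt C v = tgt C j'"
        "h0 \<cdot> v = k2" "j0 \<cdot> v = j'"
      using ju[of k2 j'] B by auto
    have "u \<in> Den C" "v \<in> Den C"
      using Den_cancel_right[of p0 u] Den_cancel_left[of j0 v] B u v p0 j0 by auto
    note T = B(1-6) B(13-17) u(1-3) v(1-3) p0(1-5) j0(1-5) q j this
    have "dfrac C (q' \<cdot> b1) (k1 \<cdot> k2) (a2 \<cdot> j')
        = dfrac C (u \<cdot> (p0 \<cdot> b1)) (u \<cdot> ((f0 \<cdot> h0) \<cdot> v)) ((a2 \<cdot> j0) \<cdot> v)"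
      unfolding u(4,5)[symmetric] v(4,5)[symmetric] using T B(19) by simp
    also have "\<dots> = dfrac C (p0 \<cdot> b1) ((f0 \<cdot> h0) \<cdot> v) ((a2 \<cdot> j0) \<cdot> v)"
      by (intro dfrac_expand_left) (simp_all add: T B(19))
    also have "\<dots> = dfrac C (p0 \<cdot> b1) (f0 \<cdot> h0) (a2 \<cdot> j0)"
      by (intro dfrac_expand_right) (simp_all add: T B(19))
    finally show ?thesis .
  qed
  show ?thesis using canonical[OF assms(1)] canonical[OF assms(2)] by simp
qed

text \<open>Mix the choices: the left square is taken from the first, the right square from the
  second. Shifting \<open>c\<close> to the right gives a choice over \<open>j\<close>,
  \<open>q\<close>, shifting it to the left one over \<open>k\<close>, \<open>r\<close>; both have
  numerator \<open>g1 c h2\<close>. Each is compared with a given choice over the same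
  factorisation.\<close>

lemma composite_unique_refine:
  assumes g: "composite_choice b1 f1 a1 b2 f2 a2 j j' q q' g1 g2"
    and h: "composite_choice b1 f1 a1 b2 f2 a2 k k' r r' h1 h2"
    and S: "j \<in> SDen C" "k \<in> SDen C" and T: "q \<in> TDen C" "r \<in> TDen C"
    and c: "c \<in> Mor C" "src C c = tgt C j" "tgt C c = src C r" "j \<cdot> c = k" "c \<cdot> r = q"
  shows "dfrac C (q' \<cdot> b1) (g1 \<cdot> g2) (a2 \<cdot> j') = dfrac C (r' \<cdot> b1) (h1 \<cdot> h2) (a2 \<cdot> k')"
proof -
  note A = composite_choiceD[OF g] note B = composite_choiceD[OF h]
  have g1c: "g1 \<cdot> (c \<cdot> r) = q' \<cdot> f1" using A c(5) by simp
  have ch: "j \<cdot> (c \<cdot> h2) = f2 \<cdot> k'" using A(1-26) B(1-26) B(29) c(1-3) c(4)[symmetric] by simp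
  have "composite_choice b1 f1 a1 b2 f2 a2 j k' q q' g1 (c \<cdot> h2)"
    by (intro composite_choiceI) (simp_all add: A B c(1-3) ch)
  from composite_unique_fixed_factor[OF g this S(1) T(1)]
  have 1: "dfrac C (q' \<cdot> b1) (g1 \<cdot> g2) (a2 \<cdot> j') = dfrac C (q' \<cdot> b1) (g1 \<cdot> (c \<cdot> h2)) (a2 \<cdot> k')" .
  have "composite_choice b1 f1 a1 b2 f2 a2 k k' r q' (g1 \<cdot> c) h2"
    by (intro composite_choiceI) (simp_all add: A(1-6,10-26) B c(1-3) g1c)
  from composite_unique_fixed_factor[OF h this S(2) T(2)] 1
  show ?thesis using A(1-26) B(1-26) c(1-3) by simp
qed

text \<open>Any two choices are compared after normalisation: if \<open>j \<cdot> q = k \<cdot> r\<close> are two factorisations into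
  an S- and a T-denominator, then a weak pushout of \<open>j\<close> and \<open>k\<close> yields a third one that refines both.\<close>

lemma composite_unique:
  assumes "composite_choice b1 f1 a1 b2 f2 a2 d d1 e e1 g1 g2"
    and "composite_choice b1 f1 a1 b2 f2 a2 d' d1' e' e1' g1' g2'"
  shows "dfrac C (e1 \<cdot> b1) (g1 \<cdot> g2) (a2 \<cdot> d1) = dfrac C (e1' \<cdot> b1) (g1' \<cdot> g2') (a2 \<cdot> d1')"
proof -
  obtain j j' q q' h1 h2 where cj: "composite_choice b1 f1 a1 b2 f2 a2 j j' q q' h1 h2"
    and j: "j \<in> SDen C" "q \<in> TDen C"
    and ej: "dfrac C (q' \<cdot> b1) (h1 \<cdot> h2) (a2 \<cdot> j') = dfrac C (e1 \<cdot> b1) (g1 \<cdot> g2) (a2 \<cdot> d1)"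
    using assms(1) by (rule composite_choice_normalise)
  obtain k k' r r' l1 l2 where ck: "composite_choice b1 f1 a1 b2 f2 a2 k k' r r' l1 l2"
    and k: "k \<in> SDen C" "r \<in> TDen C"
    and ek: "dfrac C (r' \<cdot> b1) (l1 \<cdot> l2) (a2 \<cdot> k') = dfrac C (e1' \<cdot> b1) (g1' \<cdot> g2') (a2 \<cdot> d1')"
    using assms(2) by (rule composite_choice_normalise)
  note A = composite_choiceD[OF cj] note B = composite_choiceD[OF ck]
  obtain u2 u1 where u: "u2 \<in> SDen C" "u1 \<in> Mor C" "src C u1 = tgt C j" "src C u2 = tgt C k"
      "tgt C u1 = tgt C u2" "j \<cdot> u1 = k \<cdot> u2"
    and ex: "\<And>h l. \<lbrakk>h \<in> Mor C; l \<in> Mor C; src C h = tgt C j; src C l = tgt C k; j \<cdot> h = k \<cdot> l\<rbrakk> \<Longrightarrow>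
       \<exists>u. u \<in> Mor C \<and> src C u = tgt C u2 \<and> tgt C u = tgt C h \<and> u1 \<cdot> u = h \<and> u2 \<cdot> u = l"
    by (rule SDen_pushout[of j k]) (auto simp: A B j k)
  obtain v where v: "v \<in> Mor C" "src C v = tgt C u2" "tgt C v = tgt C q" "u1 \<cdot> v = q" "u2 \<cdot> v = r"
    using ex[of q r] A B by auto
  \<comment> \<open>The induced \<open>v\<close> is a denominator since
    \<open>u2 \<cdot> v = r\<close>, but it may fail to be a T-denominator. Its S-factor
    \<open>i\<close> is therefore moved into the first factor, and the common refinement is
    \<open>j u1 i\<close> followed by \<open>p\<close>.\<close>
  have "v \<in> Den C" using Den_cancel_left[of u2 v] u v B by simp
  then obtain i p where ip: "i \<in> SDen C" "p \<in> TDen C" "src C i = tgt C u2" "tgt C i = src C p"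
      "tgt C p = tgt C q" "i \<cdot> p = v"
    by (rule Den_factor) (auto simp: v)
  have q_eq: "(u1 \<cdot> i) \<cdot> p = q" and r_eq: "(u2 \<cdot> i) \<cdot> p = r"
    using u(1-5) v ip by auto
  have m_eq: "j \<cdot> (u1 \<cdot> i) = k \<cdot> (u2 \<cdot> i)"
    by (simp add: cmp_eq_extend[OF u(6)] A(7,19) B(7,19) u(1-5) ip(1-5))
  have mp: "b2 \<cdot> a1 = (j \<cdot> (u1 \<cdot> i)) \<cdot> p"
    using q_eq by (simp add: A(7,19,27) u(1-5) ip(1-5))
  \<comment> \<open>\<open>u1\<close> may fail to be an S-denominator, so membership is read off the
    other side of the pushout square, where \<open>k\<close>, \<open>u2\<close> and \<open>i\<close>
    all are.\<close>
  have m: "j \<cdot> (u1 \<cdot> i) \<in> SDen C" unfolding m_eq using u(1-5) ip(1-5) k by simp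
  obtain s' t1 where s: "s' \<in> TDen C" "t1 \<in> Mor C" "tgt C t1 = src C p" "tgt C s' = src C f1"
      "t1 \<cdot> p = s' \<cdot> f1"
    by (rule TDen_pullback[of p f1]) (auto simp: A ip)
  obtain m' t2 where t: "m' \<in> SDen C" "t2 \<in> Mor C" "src C t2 = tgt C i" "src C m' = tgt C f2"
      "(j \<cdot> (u1 \<cdot> i)) \<cdot> t2 = f2 \<cdot> m'"
    by (rule SDen_pushout[OF m, of f2]) (auto simp: A(1-26) u(1-5) ip(1-5))
  have cm: "composite_choice b1 f1 a1 b2 f2 a2 (j \<cdot> (u1 \<cdot> i)) m' p s' t1 t2"
    by (rule composite_choiceI[OF _ _ _ _ _ _ _ _ _ _ _ _ _ _ _ _ _ _ _ _ _ _ mp s(5) t(5)])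
      (auto simp: A(1-26) u(1-5) ip(1-5) s(1-4) t(1-4) m)
  have "dfrac C (q' \<cdot> b1) (h1 \<cdot> h2) (a2 \<cdot> j') = dfrac C (s' \<cdot> b1) (t1 \<cdot> t2) (a2 \<cdot> m')"
    by (rule composite_unique_refine[OF cj cm j(1) m j(2) ip(2) _ _ _ HOL.refl q_eq])
      (auto simp: u(1-5) ip(1-5))
  moreover have "dfrac C (r' \<cdot> b1) (l1 \<cdot> l2) (a2 \<cdot> k') = dfrac C (s' \<cdot> b1) (t1 \<cdot> t2) (a2 \<cdot> m')"
    by (rule composite_unique_refine[OF ck cm k(1) m k(2) ip(2) _ _ _ m_eq[symmetric] r_eq])
      (auto simp: u(1-5) ip(1-5))
  ultimately show ?thesis using ej ek by simp
qed

text \<open>A relation on representatives, so that independence of the choice and of the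
  representatives can be stated before composition is known to be a function. Whole triples are
  arguments to suit induction on \<open>fraction_eq\<close>.\<close>

definition is_composite where
  "is_composite s t z \<longleftrightarrow>
     (\<exists>b1 f1 a1 b2 f2 a2 d d' e e' g1 g2. s = (b1, f1, a1) \<and> t = (b2, f2, a2) \<and>
        composite_choice b1 f1 a1 b2 f2 a2 d d' e e' g1 g2 \<and>
        z = dfrac C (e' \<cdot> b1) (g1 \<cdot> g2) (a2 \<cdot> d'))"

lemma is_compositeI:
  "\<lbrakk>composite_choice b1 f1 a1 b2 f2 a2 d d' e e' g1 g2;
    z = dfrac C (e' \<cdot> b1) (g1 \<cdot> g2) (a2 \<cdot> d')\<rbrakk> \<Longrightarrow> is_composite (b1, f1, a1) (b2, f2, a2) z"
  unfolding is_composite_def by blast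

lemma is_composite_unique:
  assumes "is_composite s t z" "is_composite s t z'"
  shows "z = z'"
proof -
  obtain b1 f1 a1 b2 f2 a2 where st: "s = (b1, f1, a1)" "t = (b2, f2, a2)"
    by (cases s, cases t)
  show ?thesis
    using assms unfolding is_composite_def st prod.inject
    by (elim exE conjE) (hypsubst, rule composite_unique)
qed

lemma is_compositeD:
  assumes "is_composite s t z"
  shows "s \<in> three_arrows C" "t \<in> three_arrows C" "src C (snd (snd s)) = tgt C (fst t)"
  using assms unfolding is_composite_def
  by (elim exE conjE, simp add: composite_choice_def, elim exE conjE, simp add: composite_choice_def,
      elim exE conjE, simp add: composite_choiceD)

lemma is_composite_exists:
  assumes "s \<in> three_arrows C" "t \<in> three_arrows C" "src C (snd (snd s)) = tgt C (fst t)"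
  obtains z where "is_composite s t z"
proof -
  obtain b1 f1 a1 b2 f2 a2 where st: "s = (b1, f1, a1)" "t = (b2, f2, a2)"
    by (cases s, cases t)
  show thesis
    by (rule composite_choice_exists[of b1 f1 a1 b2 f2 a2])
      (use assms in \<open>auto simp: st intro: that[unfolded st, OF is_compositeI]\<close>)
qed

text \<open>One implication suffices: a composite of \<open>s'\<close> and \<open>t\<close> exists,
  by assumption it is also a composite of \<open>s\<close> and \<open>t\<close>, and those are
  unique.\<close>

lemma is_composite_cong_left_step:
  assumes "(s, s') \<in> fraction_eq C" "\<And>z. is_composite s' t z \<Longrightarrow> is_composite s t z"
  shows "is_composite s t z \<longleftrightarrow> is_composite s' t z"
proof
  assume z: "is_composite s t z"
  then obtain z' where "is_composite s' t z'"
    using is_compositeD[OF z] fraction_eq_dest[OF assms(1)] by (auto elim!: is_composite_exists[of s' t])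
  then show "is_composite s' t z" using assms(2) z is_composite_unique by blast
qed (fact assms(2))

lemma is_composite_cong_right_step:
  assumes "(t, t') \<in> fraction_eq C" "\<And>z. is_composite s t' z \<Longrightarrow> is_composite s t z"
  shows "is_composite s t z \<longleftrightarrow> is_composite s t' z"
proof
  assume z: "is_composite s t z"
  then obtain z' where "is_composite s t' z'"
    using is_compositeD[OF z] fraction_eq_dest[OF assms(1)] by (auto elim!: is_composite_exists[of s t'])
  then show "is_composite s t' z" using assms(2) z is_composite_unique by blast
qed (fact assms(2))

text \<open>For the generators of fraction equality, a choice for the expanded 3-arrow is, up to shifting
  \<open>c\<close>, a choice for the original one, and both yield the same composite.\<close>

lemma is_composite_cong_left:
  "(s, s') \<in> fraction_eq C \<Longrightarrow> is_composite s t z \<longleftrightarrow> is_composite s' t z"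
proof (induction rule: fraction_eq.induct)
  case (expand_right b f a c)
  show ?case
  proof (rule is_composite_cong_left_step[OF fraction_eq.expand_right[OF expand_right]])
    fix z assume "is_composite (b, f \<cdot> c, a \<cdot> c) t z"
    then obtain b2 f2 a2 d d' e e' g1 g2 where t: "t = (b2, f2, a2)"
      and ch: "composite_choice b (f \<cdot> c) (a \<cdot> c) b2 f2 a2 d d' e e' g1 g2"
      and z: "z = dfrac C (e' \<cdot> b) (g1 \<cdot> g2) (a2 \<cdot> d')"
      by (auto simp: is_composite_def)
    note A = composite_choiceD[OF ch]
    have c: "c \<in> Den C" "src C c = tgt C a" and bfa: "(b, f, a) \<in> three_arrows C"
      using expand_right Den_cancel_left[of a c] by (auto simp: composable_def)
    \<comment> \<open>The given factorisation \<open>d\<close>, \<open>e\<close> need not split off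
      \<open>c\<close>. A fresh choice for \<open>(b, f, a)\<close> is used instead: with
      \<open>q \<cdot> c\<close> in place of \<open>q\<close> it becomes a choice for the expanded
      3-arrow, and uniqueness identifies the results.\<close>
    obtain j j' q q' h1 h2 where ch': "composite_choice b f a b2 f2 a2 j j' q q' h1 h2"
      by (rule composite_choice_exists[of b f a b2 f2 a2]) (use A bfa c in auto)
    note B = composite_choiceD[OF ch']
    have e1: "b2 \<cdot> (a \<cdot> c) = j \<cdot> (q \<cdot> c)" by (simp add: cmp_eq_extend[OF B(27)] B(1-26) c)
    have e2: "h1 \<cdot> (q \<cdot> c) = q' \<cdot> (f \<cdot> c)" by (simp add: cmp_eq_extend[OF B(28)] B(1-26) c)
    have "composite_choice b (f \<cdot> c) (a \<cdot> c) b2 f2 a2 j j' (q \<cdot> c) q' h1 h2"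
      by (intro composite_choiceI) (simp_all add: B(1-26,29) c e1 e2)
    then show "is_composite (b, f, a) t z"
      unfolding t z using ch' by (auto intro: is_compositeI dest: composite_unique[OF ch])
  qed
next
  case (expand_left b f a c)
  show ?case
  proof (rule is_composite_cong_left_step[OF fraction_eq.expand_left[OF expand_left]])
    fix z assume "is_composite (c \<cdot> b, c \<cdot> f, a) t z"
    then obtain b2 f2 a2 d d' e e' g1 g2 where t: "t = (b2, f2, a2)"
      and ch: "composite_choice (c \<cdot> b) (c \<cdot> f) a b2 f2 a2 d d' e e' g1 g2"
      and z: "z = dfrac C (e' \<cdot> (c \<cdot> b)) (g1 \<cdot> g2) (a2 \<cdot> d')"
      by (auto simp: is_composite_def)
    note A = composite_choiceD[OF ch]
    have c: "c \<in> Den C" "tgt C c = src C b" "src C f = src C b" "tgt C f = tgt C a" "b \<in> Den C" "f \<in> Mor C"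
      using expand_left Den_cancel_right[of b c] by (auto simp: composable_def)
    have "composite_choice b f a b2 f2 a2 d d' e (e' \<cdot> c) g1 g2"
      by (intro composite_choiceI) (simp_all add: A c)
    then show "is_composite (b, f, a) t z"
      unfolding t z using A c by (auto intro!: is_compositeI)
  qed
qed auto

lemma is_composite_cong_right:
  "(t, t') \<in> fraction_eq C \<Longrightarrow> is_composite s t z \<longleftrightarrow> is_composite s t' z"
proof (induction rule: fraction_eq.induct)
  case (expand_right b f a c)
  show ?case
  proof (rule is_composite_cong_right_step[OF fraction_eq.expand_right[OF expand_right]])
    fix z assume "is_composite s (b, f \<cdot> c, a \<cdot> c) z"
    then obtain b1 f1 a1 d d' e e' g1 g2 where s: "s = (b1, f1, a1)"
      and ch: "composite_choice b1 f1 a1 b (f \<cdot> c) (a \<cdot> c) d d' e e' g1 g2"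
      and z: "z = dfrac C (e' \<cdot> b1) (g1 \<cdot> g2) ((a \<cdot> c) \<cdot> d')"
      by (auto simp: is_composite_def)
    note A = composite_choiceD[OF ch]
    have c: "c \<in> Den C" "src C c = tgt C a" "src C f = src C b" "tgt C f = tgt C a" "a \<in> Den C" "f \<in> Mor C"
      using expand_right Den_cancel_left[of a c] by (auto simp: composable_def)
    have "composite_choice b1 f1 a1 b f a d (c \<cdot> d') e e' g1 g2"
      by (intro composite_choiceI) (simp_all add: A c)
    then show "is_composite s (b, f, a) z"
      unfolding s z using A c by (auto intro!: is_compositeI)
  qed
next
  case (expand_left b f a c)
  show ?case
  proof (rule is_composite_cong_right_step[OF fraction_eq.expand_left[OF expand_left]])
    fix z assume "is_composite s (c \<cdot> b, c \<cdot> f, a) z"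
    then obtain b1 f1 a1 d d' e e' g1 g2 where s: "s = (b1, f1, a1)"
      and ch: "composite_choice b1 f1 a1 (c \<cdot> b) (c \<cdot> f) a d d' e e' g1 g2"
      and z: "z = dfrac C (e' \<cdot> b1) (g1 \<cdot> g2) (a \<cdot> d')"
      by (auto simp: is_composite_def)
    note A = composite_choiceD[OF ch]
    have c: "c \<in> Den C" "tgt C c = src C b" and bfa: "(b, f, a) \<in> three_arrows C"
      using expand_left Den_cancel_right[of b c] by (auto simp: composable_def)
    \<comment> \<open>Again a fresh choice is transported, this time with \<open>c \<cdot> j\<close>
      in place of \<open>j\<close>.\<close>
    obtain j j' q q' h1 h2 where ch': "composite_choice b1 f1 a1 b f a j j' q q' h1 h2"
      by (rule composite_choice_exists[of b1 f1 a1 b f a]) (use A bfa c in auto)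
    note B = composite_choiceD[OF ch']
    have "composite_choice b1 f1 a1 (c \<cdot> b) (c \<cdot> f) a (c \<cdot> j) j' q q' h1 h2"
      by (intro composite_choiceI) (simp_all add: B c)
    then show "is_composite s (b, f, a) z"
      unfolding s z using ch' by (auto intro: is_compositeI dest: composite_unique[OF ch])
  qed
qed auto

text \<open>Factor \<open>u = i \<cdot> p\<close> and push \<open>i\<close> out along
  \<open>f\<close>, with \<open>k\<close> opposite to \<open>i\<close>. The morphism
  \<open>w\<close> induced by \<open>p \<cdot> g\<close> and \<open>v\<close> satisfies
  \<open>k \<cdot> w = v\<close>, so it is a denominator and can be factored in turn; its S-part is
  appended to \<open>k\<close>. Thus factorisations of denominators can be chosen compatibly with a
  given square.\<close>

lemma square_factor:
  assumes "u \<in> Den C" "v \<in> Den C" "f \<in> Mor C" "g \<in> Mor C"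
    "src C u = X" "tgt C u = Y" "src C v = Z" "tgt C v = W"
    "src C f = X" "tgt C f = Z" "src C g = Y" "tgt C g = W" "u \<cdot> g = f \<cdot> v"
  obtains i p i' p' h where "i \<in> SDen C" "p \<in> TDen C" "i' \<in> SDen C" "p' \<in> TDen C" "h \<in> Mor C"
    "src C i = X" "tgt C i = src C p" "tgt C p = Y" "src C i' = Z" "tgt C i' = src C p'" "tgt C p' = W"
    "src C h = src C p" "tgt C h = src C p'"
    "i \<cdot> p = u" "i' \<cdot> p' = v" "i \<cdot> h = f \<cdot> i'" "h \<cdot> p' = p \<cdot> g"
proof -
  obtain i p where ip: "i \<in> SDen C" "p \<in> TDen C" "src C i = X" "tgt C i = src C p"
      "tgt C p = Y" "i \<cdot> p = u"
    by (rule Den_factor[OF assms(1,5,6)])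
  obtain k h where k: "k \<in> SDen C" "h \<in> Mor C" "src C h = src C p" "src C k = Z"
      "tgt C h = tgt C k" "i \<cdot> h = f \<cdot> k"
    and ex: "\<And>h' l. \<lbrakk>h' \<in> Mor C; l \<in> Mor C; src C h' = tgt C i; src C l = tgt C f; i \<cdot> h' = f \<cdot> l\<rbrakk> \<Longrightarrow>
       \<exists>u. u \<in> Mor C \<and> src C u = tgt C k \<and> tgt C u = tgt C h' \<and> h \<cdot> u = h' \<and> k \<cdot> u = l"
    by (rule SDen_pushout[of i f]) (auto simp: ip assms)
  have "i \<cdot> (p \<cdot> g) = (i \<cdot> p) \<cdot> g" using ip(1-5) assms(1-12) by simp
  then have "i \<cdot> (p \<cdot> g) = f \<cdot> v" unfolding ip(6) assms(13) .
  then obtain w where w: "w \<in> Mor C" "src C w = tgt C k" "tgt C w = W" "h \<cdot> w = p \<cdot> g" "k \<cdot> w = v"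
    using ex[of "p \<cdot> g" v] ip(1-5) assms(1-12) by auto
  have "w \<in> Den C" using Den_cancel_left[of k w] k w assms by simp
  then obtain i' p' where ip': "i' \<in> SDen C" "p' \<in> TDen C" "src C i' = tgt C k" "tgt C i' = src C p'"
      "tgt C p' = W" "i' \<cdot> p' = w"
    by (rule Den_factor) (auto simp: w)
  have e: "i \<cdot> (h \<cdot> i') = f \<cdot> (k \<cdot> i')"
    by (simp add: cmp_eq_extend[OF k(6)] ip(1-5) k(1-5) ip'(1-5) assms(1-12))
  show thesis
    by (rule that[of i p "k \<cdot> i'" p' "h \<cdot> i'"])
      (auto simp: ip(1-6) k(1-5) ip'(1-6) assms(1-12) w e)
qed

text \<open>The two pairwise composites meet over \<open>f2\<close>: their squares paste to one from
  \<open>r' \<cdot> j\<close> to \<open>r \<cdot> j'\<close>. Factoring it through \<open>h\<close>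
  supplies the inner denominators of both bracketings at once. After \<open>n\<close> is pulled back
  along \<open>g1\<close> and \<open>l\<close> pushed out along \<open>h3\<close>, both triple
  composites have the numerator \<open>g1' h h3'\<close> and the same outer denominators.\<close>

lemma is_composite_assoc:
  assumes "(b1, f1, a1) \<in> three_arrows C" "(b2, f2, a2) \<in> three_arrows C" "(b3, f3, a3) \<in> three_arrows C"
    "src C a1 = tgt C b2" "src C a2 = tgt C b3"
  obtains b12 f12 a12 b23 f23 a23 z where
    "is_composite (b1, f1, a1) (b2, f2, a2) (dfrac C b12 f12 a12)"
    "is_composite (b2, f2, a2) (b3, f3, a3) (dfrac C b23 f23 a23)"
    "is_composite (b12, f12, a12) (b3, f3, a3) z"
    "is_composite (b1, f1, a1) (b23, f23, a23) z"
proof -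
  obtain j j' q q' g1 g2 where ch12: "composite_choice b1 f1 a1 b2 f2 a2 j j' q q' g1 g2"
    and jq: "j \<in> SDen C" "j' \<in> SDen C" "q \<in> TDen C" "q' \<in> TDen C"
    using assms(1,2,4) by (rule composite_choice_exists)
  obtain k k' r r' h2 h3 where ch23: "composite_choice b2 f2 a2 b3 f3 a3 k k' r r' h2 h3"
    and kr: "k \<in> SDen C" "k' \<in> SDen C" "r \<in> TDen C" "r' \<in> TDen C"
    using assms(2,3,5) by (rule composite_choice_exists)
  note A = composite_choiceD[OF ch12] note B = composite_choiceD[OF ch23]
  have sq: "(r' \<cdot> j) \<cdot> g2 = h2 \<cdot> (r \<cdot> j')"
    by (simp add: cmp_eq_extend[OF B(28)] A(1-26,29) B(1-26))
  obtain m n l s h where mn: "m \<in> SDen C" "n \<in> TDen C" "l \<in> SDen C" "s \<in> TDen C" "h \<in> Mor C"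
    "src C m = src C r'" "tgt C m = src C n" "tgt C n = tgt C j"
    "src C l = tgt C k" "tgt C l = src C s" "tgt C s = tgt C j'"
    "src C h = src C n" "tgt C h = src C s"
    "m \<cdot> n = r' \<cdot> j" "l \<cdot> s = r \<cdot> j'" "m \<cdot> h = h2 \<cdot> l" "h \<cdot> s = n \<cdot> g2"
    by (rule square_factor[OF _ _ _ _ _ _ _ _ _ _ _ _ sq, of "src C r'" "tgt C j" "tgt C k" "tgt C j'"])
      (auto simp: A(1-26) B(1-26))
  obtain n' g1' where n': "n' \<in> TDen C" "g1' \<in> Mor C" "tgt C g1' = src C n" "tgt C n' = src C q'"
      "src C g1' = src C n'" "g1' \<cdot> n = n' \<cdot> g1"
    by (rule TDen_pullback[of n g1]) (auto simp: A mn)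
  obtain l' h3' where l': "l' \<in> SDen C" "h3' \<in> Mor C" "src C h3' = src C s" "src C l' = tgt C k'"
      "tgt C h3' = tgt C l'" "l \<cdot> h3' = h3 \<cdot> l'"
    by (rule SDen_pushout[of l h3]) (auto simp: B mn)
  note T = A(1-26) B(1-26) mn(1-13) n'(1-5) l'(1-5)
  have e1: "b3 \<cdot> (a2 \<cdot> j') = k \<cdot> (l \<cdot> s)"
    unfolding mn(15) by (simp add: cmp_eq_extend[OF B(27)] T)
  have e2: "g1' \<cdot> (h \<cdot> s) = n' \<cdot> (g1 \<cdot> g2)"
    unfolding mn(17) by (simp add: cmp_eq_extend[OF n'(6)] T)
  have e3: "k \<cdot> (l \<cdot> h3') = f3 \<cdot> (k' \<cdot> l')"
    unfolding l'(6) by (simp add: cmp_eq_extend[OF B(29)] T)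
  have "composite_choice (q' \<cdot> b1) (g1 \<cdot> g2) (a2 \<cdot> j') b3 f3 a3 (k \<cdot> l) (k' \<cdot> l') s n' (g1' \<cdot> h) h3'"
    by (intro composite_choiceI) (simp_all add: T e1 e2 e3)
  then have c1: "is_composite (q' \<cdot> b1, g1 \<cdot> g2, a2 \<cdot> j') (b3, f3, a3)
      (dfrac C (n' \<cdot> (q' \<cdot> b1)) ((g1' \<cdot> h) \<cdot> h3') (a3 \<cdot> (k' \<cdot> l')))"
    by (auto intro: is_compositeI)
  have "r' \<cdot> (j \<cdot> q) = m \<cdot> (n \<cdot> q)"
    by (simp add: cmp_eq_extend[OF mn(14)] T)
  then have e4: "(r' \<cdot> b2) \<cdot> a1 = m \<cdot> (n \<cdot> q)" using T A(27) by simp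
  have e5: "g1' \<cdot> (n \<cdot> q) = n' \<cdot> (q' \<cdot> f1)"
    by (simp add: cmp_eq_extend[OF n'(6)] T A(28))
  have e6: "m \<cdot> (h \<cdot> h3') = h2 \<cdot> (h3 \<cdot> l')"
    by (simp add: cmp_eq_extend[OF mn(16)] T l'(6))
  have "composite_choice b1 f1 a1 (r' \<cdot> b2) (h2 \<cdot> h3) (a3 \<cdot> k') m l' (n \<cdot> q) (n' \<cdot> q') g1' (h \<cdot> h3')"
    by (intro composite_choiceI) (simp_all add: T e4 e5 e6)
  then have "is_composite (b1, f1, a1) (r' \<cdot> b2, h2 \<cdot> h3, a3 \<cdot> k')
      (dfrac C ((n' \<cdot> q') \<cdot> b1) (g1' \<cdot> (h \<cdot> h3')) ((a3 \<cdot> k') \<cdot> l'))"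
    by (auto intro: is_compositeI)
  moreover have "dfrac C ((n' \<cdot> q') \<cdot> b1) (g1' \<cdot> (h \<cdot> h3')) ((a3 \<cdot> k') \<cdot> l')
      = dfrac C (n' \<cdot> (q' \<cdot> b1)) ((g1' \<cdot> h) \<cdot> h3') (a3 \<cdot> (k' \<cdot> l'))"
    by (simp add: T)
  ultimately show thesis
    using that[OF is_compositeI[OF ch12 HOL.refl] is_compositeI[OF ch23 HOL.refl] c1] by simp
qed

end

subsection \<open>The fraction category and its universal property\<close>

context category
begin

lemma inv_mor_eq:
  assumes "is_inverse C f g"
  shows "inv_mor C f = g"
  unfolding inv_mor_def
proof (rule the_equality)
  fix h assume "is_inverse C f h"
  then have "h = h \<cdot> (f \<cdot> g)" "h \<cdot> f \<cdot> g = g" "h \<in> Mor C" "f \<in> Mor C" "g \<in> Mor C"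
      "tgt C h = src C f" "tgt C f = src C g"
    using assms by (auto simp: is_inverse_def composable_def)
  then show "h = g" by simp
qed (fact assms)

lemma is_inverse_inv_mor: "invertible C f \<Longrightarrow> is_inverse C f (inv_mor C f)"
  using inv_mor_eq by (auto simp: invertible_def)

lemma inv_mor_simps [simp]:
  assumes "invertible C f"
  shows "f \<in> Mor C" "inv_mor C f \<in> Mor C" "src C (inv_mor C f) = tgt C f" "tgt C (inv_mor C f) = src C f"
    "f \<cdot> inv_mor C f = ident C (src C f)" "inv_mor C f \<cdot> f = ident C (tgt C f)"
  using is_inverse_inv_mor[OF assms] by (auto simp: is_inverse_def composable_def)

lemma inv_mor_cancel [simp]:
  assumes "invertible C f" "x \<in> Mor C"
  shows "src C x = tgt C f \<Longrightarrow> inv_mor C f \<cdot> (f \<cdot> x) = x"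
    and "src C x = src C f \<Longrightarrow> f \<cdot> (inv_mor C f \<cdot> x) = x"
  using assms by (simp_all flip: assoc)

lemma inv_mor_cmp:
  assumes "invertible C f" "invertible C g" "tgt C f = src C g"
  shows "inv_mor C (f \<cdot> g) = inv_mor C g \<cdot> inv_mor C f"
  using assms by (intro inv_mor_eq) (simp add: is_inverse_def composable_def)

lemma inv_mor_ident [simp]: "X \<in> Ob C \<Longrightarrow> inv_mor C (ident C X) = ident C X"
  by (rule inv_mor_eq) (simp add: is_inverse_def composable_def)

text \<open>Cancel \<open>e'\<close> on the left and \<open>e\<close> on the right. This moves
  inverses across the squares of the composition rule and across naturality squares.\<close>

lemma inv_mor_swap:
  assumes "g \<cdot> e = e' \<cdot> f" "invertible C e" "invertible C e'" "f \<in> Mor C" "g \<in> Mor C"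
    "tgt C g = src C e" "tgt C e' = src C f"
  shows "inv_mor C e' \<cdot> g = f \<cdot> inv_mor C e"
proof -
  have ends: "src C g = src C e'" "tgt C f = tgt C e"
    using assms src_cmp[of g e] src_cmp[of e' f] tgt_cmp[of g e] tgt_cmp[of e' f] by auto
  have "inv_mor C e' \<cdot> g = inv_mor C e' \<cdot> ((g \<cdot> e) \<cdot> inv_mor C e)"
    using assms(2-7) ends by simp
  also have "\<dots> = f \<cdot> inv_mor C e"
    unfolding assms(1) using assms(2-7) ends by simp
  finally show ?thesis .
qed

end

section \<open>\<open>Frac C\<close> as a category and \<open>loc C\<close> as a functor\<close>

context uni_fractionable
begin

lemma Ob_Frac [simp]: "Ob (Frac C) = Ob C"
  and ident_Frac [simp]: "ident (Frac C) X = dfrac C (ident C X) (ident C X) (ident C X)"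
  by (simp_all add: Frac_def)

lemma Mor_Frac: "Mor (Frac C) = {dfrac C b f a | b f a. (b, f, a) \<in> three_arrows C}"
  by (fastforce simp: Frac_def quotient_def dfrac_def)

lemma dfrac_Mor [simp]: "(b, f, a) \<in> three_arrows C \<Longrightarrow> dfrac C b f a \<in> Mor (Frac C)"
  unfolding Mor_Frac by blast

lemma Mor_FracE:
  assumes "x \<in> Mor (Frac C)"
  obtains b f a where "(b, f, a) \<in> three_arrows C" "x = dfrac C b f a"
  using assms unfolding Mor_Frac by blast

lemma src_Frac [simp]:
  assumes "(b, f, a) \<in> three_arrows C"
  shows "src (Frac C) (dfrac C b f a) = tgt C b"
  unfolding Frac_def category.simps
proof (rule the_equality)
  show "\<exists>b' f' a'. (b', f', a') \<in> three_arrows C \<and> dfrac C b f a = dfrac C b' f' a' \<and> tgt C b = tgt C b'"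
    using assms by blast
next
  fix X assume "\<exists>b' f' a'. (b', f', a') \<in> three_arrows C \<and> dfrac C b f a = dfrac C b' f' a' \<and> X = tgt C b'"
  then show "X = tgt C b" using dfrac_endpoints(1)[OF _ assms] by metis
qed

lemma tgt_Frac [simp]:
  assumes "(b, f, a) \<in> three_arrows C"
  shows "tgt (Frac C) (dfrac C b f a) = src C a"
  unfolding Frac_def category.simps
proof (rule the_equality)
  show "\<exists>b' f' a'. (b', f', a') \<in> three_arrows C \<and> dfrac C b f a = dfrac C b' f' a' \<and> src C a = src C a'"
    using assms by blast
next
  fix X assume "\<exists>b' f' a'. (b', f', a') \<in> three_arrows C \<and> dfrac C b f a = dfrac C b' f' a' \<and> X = src C a'"
  then show "X = src C a" using dfrac_endpoints(2)[OF _ assms] by metis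
qed

text \<open>\<open>is_frac_composite\<close> may use other representatives; the congruence lemmas
  carry its result back to the given ones, where composites are unique. Since \<open>z\<close> may
  stem from arbitrary denominators, this is already the composition rule of part (a).\<close>

lemma cmp_Frac:
  assumes z: "is_composite (b1, f1, a1) (b2, f2, a2) z"
  shows "dfrac C b1 f1 a1 \<cdot>\<^bsub>Frac C\<^esub> dfrac C b2 f2 a2 = z"
proof -
  note D = is_compositeD[OF z]
  have unique: "z' = z" if z': "is_frac_composite C (dfrac C b1 f1 a1) (dfrac C b2 f2 a2) z'" for z'
  proof -
    obtain b1' f1' a1' b2' f2' a2' j q q' g1 j' g2 where c:
      "(b1', f1', a1') \<in> three_arrows C" "dfrac C b1 f1 a1 = dfrac C b1' f1' a1'"
      "(b2', f2', a2') \<in> three_arrows C" "dfrac C b2 f2 a2 = dfrac C b2' f2' a2'"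
      "j \<in> SDen C" "q \<in> TDen C" "commutes C b2' a1' j q"
      "q' \<in> TDen C" "commutes C g1 q q' f1'" "j' \<in> SDen C" "commutes C j g2 f2' j'"
      "z' = dfrac C (q' \<cdot> b1') (g1 \<cdot> g2) (a2' \<cdot> j')"
      using z' unfolding is_frac_composite_def by blast
    have "composite_choice b1' f1' a1' b2' f2' a2' j j' q q' g1 g2"
      unfolding composite_choice_def using c by simp
    then have "is_composite (b1', f1', a1') (b2', f2', a2') z'"
      using c(12) by (rule is_compositeI)
    moreover have "((b1, f1, a1), (b1', f1', a1')) \<in> fraction_eq C"
      "((b2, f2, a2), (b2', f2', a2')) \<in> fraction_eq C"
      using dfrac_eq_iff D c by blast+
    ultimately have "is_composite (b1, f1, a1) (b2, f2, a2) z'"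
      using is_composite_cong_left is_composite_cong_right by blast
    then show ?thesis using z by (rule is_composite_unique)
  qed
  obtain j j' q q' g1 g2 where ch: "composite_choice b1 f1 a1 b2 f2 a2 j j' q q' g1 g2"
    and ST: "j \<in> SDen C" "j' \<in> SDen C" "q \<in> TDen C" "q' \<in> TDen C"
    using D(1,2) D(3)[unfolded fst_conv snd_conv] by (rule composite_choice_exists)
  have "is_frac_composite C (dfrac C b1 f1 a1) (dfrac C b2 f2 a2)
      (dfrac C (q' \<cdot> b1) (g1 \<cdot> g2) (a2 \<cdot> j'))"
    unfolding is_frac_composite_def using ch[unfolded composite_choice_def] ST by blast
  then show ?thesis unfolding Frac_def category.simps by (metis (no_types, lifting) the_equality unique)
qed

lemma is_composite_dfrac:
  assumes "is_composite (b1, f1, a1) (b2, f2, a2) z"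
  obtains b f a where "(b, f, a) \<in> three_arrows C" "z = dfrac C b f a" "tgt C b = tgt C b1" "src C a = src C a2"
proof -
  obtain d d' e e' g1 g2 where ch: "composite_choice b1 f1 a1 b2 f2 a2 d d' e e' g1 g2"
    and z: "z = dfrac C (e' \<cdot> b1) (g1 \<cdot> g2) (a2 \<cdot> d')"
    using assms unfolding is_composite_def by blast
  note A = composite_choiceD[OF ch]
  show thesis by (rule that[OF _ z]) (simp_all add: A)
qed

lemma is_composite_exists_three_arrows:
  assumes "(b1, f1, a1) \<in> three_arrows C" "(b2, f2, a2) \<in> three_arrows C" "src C a1 = tgt C b2"
  obtains z where "is_composite (b1, f1, a1) (b2, f2, a2) z"
  using assms by (metis fst_conv is_composite_exists snd_conv)

lemma is_composite_ident_left:
  assumes "(b, f, a) \<in> three_arrows C"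
  shows "is_composite (ident C (tgt C b), ident C (tgt C b), ident C (tgt C b)) (b, f, a) (dfrac C b f a)"
proof (rule is_compositeI)
  show "composite_choice (ident C (tgt C b)) (ident C (tgt C b)) (ident C (tgt C b)) b f a
      (ident C (src C b)) (ident C (tgt C a)) b b (ident C (src C b)) f"
    using assms by (intro composite_choiceI) simp_all
qed (use assms in simp)

lemma is_composite_ident_right:
  assumes "(b, f, a) \<in> three_arrows C"
  shows "is_composite (b, f, a) (ident C (src C a), ident C (src C a), ident C (src C a)) (dfrac C b f a)"
proof (rule is_compositeI)
  show "composite_choice b f a (ident C (src C a)) (ident C (src C a)) (ident C (src C a))
      a a (ident C (tgt C a)) (ident C (src C b)) f (ident C (tgt C a))"
    using assms by (intro composite_choiceI) simp_all
qed (use assms in simp)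

text \<open>Multiplying by \<open>loc\<close> of \<open>p\<close> removes a trailing
  \<open>p\<close> from the left denominator: with \<open>e = b \<cdot> p\<close> and
  \<open>e' = b\<close> the remaining data can be identities and \<open>f\<close>. The case of an
  identity \<open>b\<close> gives an inverse law; the general case allows cancellation of
  denominators.\<close>

lemma is_composite_loc_left:
  assumes "(b \<cdot> p, f, a) \<in> three_arrows C" "b \<in> Den C" "p \<in> Den C" "tgt C b = src C p"
  shows "is_composite (ident C (src C p), p, ident C (tgt C p)) (b \<cdot> p, f, a) (dfrac C b f a)"
proof (rule is_compositeI)
  show "composite_choice (ident C (src C p)) p (ident C (tgt C p)) (b \<cdot> p) f a
      (ident C (src C b)) (ident C (tgt C a)) (b \<cdot> p) b (ident C (src C b)) f"
    using assms by (intro composite_choiceI) simp_all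
qed (use assms in simp)

lemma is_composite_loc_right:
  assumes "(b, f, i \<cdot> a) \<in> three_arrows C" "a \<in> Den C" "i \<in> Den C" "tgt C i = src C a"
  shows "is_composite (b, f, i \<cdot> a) (ident C (src C i), i, ident C (tgt C i)) (dfrac C b f a)"
proof (rule is_compositeI)
  show "composite_choice b f (i \<cdot> a) (ident C (src C i)) i (ident C (tgt C i))
      (i \<cdot> a) a (ident C (tgt C a)) (ident C (src C b)) f (ident C (tgt C a))"
    using assms by (intro composite_choiceI) simp_all
qed (use assms in simp)

lemma category_Frac: "category (Frac C)"
proof
  fix x assume "x \<in> Mor (Frac C)"
  then obtain b f a where x: "(b, f, a) \<in> three_arrows C" "x = dfrac C b f a" by (rule Mor_FracE)
  show "src (Frac C) x \<in> Ob (Frac C)" "tgt (Frac C) x \<in> Ob (Frac C)"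
    unfolding x(2) src_Frac[OF x(1)] tgt_Frac[OF x(1)] using x(1) by simp_all
  show "ident (Frac C) (src (Frac C) x) \<cdot>\<^bsub>Frac C\<^esub> x = x"
    unfolding x(2) src_Frac[OF x(1)] ident_Frac by (rule cmp_Frac[OF is_composite_ident_left[OF x(1)]])
  show "x \<cdot>\<^bsub>Frac C\<^esub> ident (Frac C) (tgt (Frac C) x) = x"
    unfolding x(2) tgt_Frac[OF x(1)] ident_Frac by (rule cmp_Frac[OF is_composite_ident_right[OF x(1)]])
next
  fix X assume "X \<in> Ob (Frac C)"
  then have "(ident C X, ident C X, ident C X) \<in> three_arrows C" "X \<in> Ob C" by simp_all
  then show "ident (Frac C) X \<in> hom (Frac C) X X" by (simp add: hom_def)
next
  fix x y assume "composable (Frac C) x y"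
  then obtain b1 f1 a1 b2 f2 a2 where xy: "(b1, f1, a1) \<in> three_arrows C" "x = dfrac C b1 f1 a1"
      "(b2, f2, a2) \<in> three_arrows C" "y = dfrac C b2 f2 a2" "tgt (Frac C) x = src (Frac C) y"
    unfolding composable_def by (elim conjE Mor_FracE)
  have "src C a1 = tgt C b2"
    using xy(5) unfolding xy(2,4) src_Frac[OF xy(3)] tgt_Frac[OF xy(1)] .
  then obtain z where z: "is_composite (b1, f1, a1) (b2, f2, a2) z"
    by (rule is_composite_exists_three_arrows[OF xy(1,3)])
  obtain b f a where bfa: "(b, f, a) \<in> three_arrows C" "z = dfrac C b f a" "tgt C b = tgt C b1" "src C a = src C a2"
    using z by (rule is_composite_dfrac)
  show "x \<cdot>\<^bsub>Frac C\<^esub> y \<in> hom (Frac C) (src (Frac C) x) (tgt (Frac C) y)"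
    unfolding xy(2,4) cmp_Frac[OF z] hom_def mem_Collect_eq src_Frac[OF xy(1)] tgt_Frac[OF xy(3)]
    using bfa by simp
next
  fix x y w assume "composable (Frac C) x y" "composable (Frac C) y w"
  then obtain b1 f1 a1 b2 f2 a2 b3 f3 a3 where
    xyw: "(b1, f1, a1) \<in> three_arrows C" "(b2, f2, a2) \<in> three_arrows C" "(b3, f3, a3) \<in> three_arrows C"
      "x = dfrac C b1 f1 a1" "y = dfrac C b2 f2 a2" "w = dfrac C b3 f3 a3"
    and ends: "tgt (Frac C) x = src (Frac C) y" "tgt (Frac C) y = src (Frac C) w"
    unfolding composable_def by (elim conjE Mor_FracE)
  have "src C a1 = tgt C b2" "src C a2 = tgt C b3"
    using ends unfolding xyw(4-6) src_Frac[OF xyw(2)] src_Frac[OF xyw(3)] tgt_Frac[OF xyw(1)]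
      tgt_Frac[OF xyw(2)] by simp_all
  then obtain b12 f12 a12 b23 f23 a23 z where
    "is_composite (b1, f1, a1) (b2, f2, a2) (dfrac C b12 f12 a12)"
    "is_composite (b2, f2, a2) (b3, f3, a3) (dfrac C b23 f23 a23)"
    "is_composite (b12, f12, a12) (b3, f3, a3) z"
    "is_composite (b1, f1, a1) (b23, f23, a23) z"
    by (rule is_composite_assoc[OF xyw(1-3)])
  then show "(x \<cdot>\<^bsub>Frac C\<^esub> y) \<cdot>\<^bsub>Frac C\<^esub> w = x \<cdot>\<^bsub>Frac C\<^esub> (y \<cdot>\<^bsub>Frac C\<^esub> w)"
    unfolding xyw(4-6) by (simp add: cmp_Frac)
qed

lemma obj_loc [simp]: "obj (loc C) X = X"
  and mor_loc: "mor (loc C) f = dfrac C (ident C (src C f)) f (ident C (tgt C f))"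
  by (simp_all add: loc_def)

lemma is_functor_loc: "is_functor C (Frac C) (loc C)"
  unfolding is_functor_def
proof (intro conjI ballI allI impI)
  fix f g assume "composable C f g"
  then have fg: "f \<in> Mor C" "g \<in> Mor C" "tgt C f = src C g" by (simp_all add: composable_def)
  have "composite_choice (ident C (src C f)) f (ident C (tgt C f)) (ident C (src C g)) g (ident C (tgt C g))
      (ident C (src C g)) (ident C (tgt C g)) (ident C (src C g)) (ident C (src C f)) f g"
    using fg by (intro composite_choiceI) simp_all
  from cmp_Frac[OF is_compositeI[OF this HOL.refl]]
  show "mor (loc C) (f \<cdot> g) = mor (loc C) f \<cdot>\<^bsub>Frac C\<^esub> mor (loc C) g"
    using fg by (simp add: mor_loc)
qed (auto simp: hom_def mor_loc category_Frac category_axioms)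

text \<open>Both sides contract from \<open>dfrac C d d d\<close>, one by a right and one by a left
  expansion by \<open>d\<close>.\<close>

lemma dfrac_inverse:
  assumes "d \<in> Den C"
  shows "dfrac C d (ident C (src C d)) (ident C (src C d)) = dfrac C (ident C (tgt C d)) (ident C (tgt C d)) d"
  using dfrac_expand_right[of d "ident C (src C d)" "ident C (src C d)" d]
    dfrac_expand_left[of "ident C (tgt C d)" "ident C (tgt C d)" d d] assms by simp

lemma is_inverse_loc:
  assumes d: "d \<in> Den C"
  shows "is_inverse (Frac C) (mor (loc C) d) (dfrac C d (ident C (src C d)) (ident C (src C d)))"
proof -
  have t: "(ident C (src C d), d, ident C (tgt C d)) \<in> three_arrows C"
    "(d, ident C (src C d), ident C (src C d)) \<in> three_arrows C" using d by simp_all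
  have "is_composite (ident C (src C d), d, ident C (tgt C d))
      (ident C (src C d) \<cdot> d, ident C (src C d), ident C (src C d))
      (dfrac C (ident C (src C d)) (ident C (src C d)) (ident C (src C d)))"
    using d by (intro is_composite_loc_left) simp_all
  from cmp_Frac[OF this] d
  have 1: "mor (loc C) d \<cdot>\<^bsub>Frac C\<^esub> dfrac C d (ident C (src C d)) (ident C (src C d))
      = ident (Frac C) (src C d)"
    by (simp add: mor_loc)
  have "is_composite (ident C (tgt C d), ident C (tgt C d), d \<cdot> ident C (tgt C d))
      (ident C (src C d), d, ident C (tgt C d))
      (dfrac C (ident C (tgt C d)) (ident C (tgt C d)) (ident C (tgt C d)))"
    using d by (intro is_composite_loc_right) simp_all
  from cmp_Frac[OF this] d
  have 2: "dfrac C d (ident C (src C d)) (ident C (src C d)) \<cdot>\<^bsub>Frac C\<^esub> mor (loc C) d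
      = ident (Frac C) (tgt C d)"
    by (simp add: mor_loc dfrac_inverse)
  show ?thesis
    unfolding is_inverse_def composable_def using 1 2 t d by (simp add: mor_loc del: three_arrows_iff)
qed

end

section \<open>Extending functors that invert the denominators\<close>

locale inverting_functor = uni_fractionable C + D: category D
  for C :: "('o, 'm, 'z) unifrac_category_scheme" (structure)
    and D :: "('p, 'n, 'y) category_scheme" +
  fixes F :: "('o, 'm, 'p, 'n) cat_functor"
  assumes F_functor: "is_functor C D F"
    and F_inverts: "inverts (Den C) D F"
begin

lemma F_simps [simp]:
  "X \<in> Ob C \<Longrightarrow> obj F X \<in> Ob D"
  "f \<in> Mor C \<Longrightarrow> mor F f \<in> Mor D"
  "f \<in> Mor C \<Longrightarrow> src D (mor F f) = obj F (src C f)"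
  "f \<in> Mor C \<Longrightarrow> tgt D (mor F f) = obj F (tgt C f)"
  "X \<in> Ob C \<Longrightarrow> mor F (ident C X) = ident D (obj F X)"
  "\<lbrakk>f \<in> Mor C; g \<in> Mor C; tgt C f = src C g\<rbrakk> \<Longrightarrow> mor F (f \<cdot> g) = mor F f \<cdot>\<^bsub>D\<^esub> mor F g"
  "d \<in> Den C \<Longrightarrow> invertible D (mor F d)"
  using F_functor F_inverts by (auto simp: is_functor_def hom_def composable_def inverts_def)

definition frac_value :: "'m \<times> 'm \<times> 'm \<Rightarrow> 'n" where
  "frac_value = (\<lambda>(b, f, a). inv_mor D (mor F b) \<cdot>\<^bsub>D\<^esub> mor F f \<cdot>\<^bsub>D\<^esub> inv_mor D (mor F a))"

text \<open>An expansion requires only the products with \<open>c\<close> to be denominators, but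
  cancellation makes \<open>c\<close> one as well. Hence \<open>F\<close> inverts \<open>c\<close>,
  and it drops out of the value.\<close>

lemma frac_value_cong: "(s, t) \<in> fraction_eq C \<Longrightarrow> frac_value s = frac_value t"
proof (induction rule: fraction_eq.induct)
  case (expand_right b f a c)
  then have "c \<in> Den C" "src C c = tgt C a" using Den_cancel_left[of a c] by (auto simp: composable_def)
  then show ?case using expand_right by (simp add: frac_value_def D.inv_mor_cmp)
next
  case (expand_left b f a c)
  then have "c \<in> Den C" "tgt C c = src C b" using Den_cancel_right[of b c] by (auto simp: composable_def)
  then show ?case using expand_left by (simp add: frac_value_def D.inv_mor_cmp)
qed auto

text \<open>Each square of the choice becomes an exchange rule in \<open>D\<close>:
  \<open>s1\<close> and \<open>s2\<close> move inverses past numerators, \<open>s3\<close> inverts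
  \<open>b2 a1 = d e\<close>.\<close>

lemma frac_value_composite:
  assumes "composite_choice b1 f1 a1 b2 f2 a2 d d' e e' g1 g2"
  shows "frac_value (e' \<cdot> b1, g1 \<cdot> g2, a2 \<cdot> d') = frac_value (b1, f1, a1) \<cdot>\<^bsub>D\<^esub> frac_value (b2, f2, a2)"
proof -
  note A = composite_choiceD[OF assms]
  let ?i = "\<lambda>x. inv_mor D (mor F x)"
  have s1: "?i e' \<cdot>\<^bsub>D\<^esub> mor F g1 = mor F f1 \<cdot>\<^bsub>D\<^esub> ?i e"
    using A(28) by (intro D.inv_mor_swap) (simp_all add: A(1-26) flip: F_simps(6))
  have s2: "?i d \<cdot>\<^bsub>D\<^esub> mor F f2 = mor F g2 \<cdot>\<^bsub>D\<^esub> ?i d'"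
    using A(29) by (intro D.inv_mor_swap) (simp_all add: A(1-26) flip: F_simps(6))
  have "?i (b2 \<cdot> a1) = ?i (d \<cdot> e)" using A(27) by simp
  then have s3: "?i a1 \<cdot>\<^bsub>D\<^esub> ?i b2 = ?i e \<cdot>\<^bsub>D\<^esub> ?i d" by (simp add: A(1-26) D.inv_mor_cmp)
  have "frac_value (e' \<cdot> b1, g1 \<cdot> g2, a2 \<cdot> d')
      = ?i b1 \<cdot>\<^bsub>D\<^esub> ((?i e' \<cdot>\<^bsub>D\<^esub> mor F g1) \<cdot>\<^bsub>D\<^esub> ((mor F g2 \<cdot>\<^bsub>D\<^esub> ?i d') \<cdot>\<^bsub>D\<^esub> ?i a2))"
    by (simp add: frac_value_def A(1-26) D.inv_mor_cmp)
  also have "\<dots> = ?i b1 \<cdot>\<^bsub>D\<^esub> (mor F f1 \<cdot>\<^bsub>D\<^esub> ((?i e \<cdot>\<^bsub>D\<^esub> ?i d) \<cdot>\<^bsub>D\<^esub> (mor F f2 \<cdot>\<^bsub>D\<^esub> ?i a2)))"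
    unfolding s1 s2[symmetric] by (simp add: A(1-26))
  also have "\<dots> = frac_value (b1, f1, a1) \<cdot>\<^bsub>D\<^esub> frac_value (b2, f2, a2)"
    unfolding s3[symmetric] by (simp add: frac_value_def A(1-26))
  finally show ?thesis .
qed

text \<open>Stated for an arbitrary candidate \<open>Fh\<close>, so that uniqueness, the formula and
  functoriality come from one equivalence. For the forward direction, multiplying
  \<open>dfrac C b f a\<close> by \<open>loc\<close> of \<open>b\<close> on the left and of
  \<open>a\<close> on the right yields \<open>loc\<close> of \<open>f\<close>; since
  \<open>F\<close> inverts \<open>b\<close> and \<open>a\<close>, the value is forced. The converse
  rests on \<open>frac_value_composite\<close>.\<close>

lemma extension_iff:
  "is_functor (Frac C) D Fh \<and> functor_eq C F (functor_comp Fh (loc C)) \<longleftrightarrow>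
     (\<forall>X \<in> Ob C. obj Fh X = obj F X) \<and>
     (\<forall>b f a. (b, f, a) \<in> three_arrows C \<longrightarrow> mor Fh (dfrac C b f a) = frac_value (b, f, a))"
  (is "?L \<longleftrightarrow> ?R")
proof
  assume L: ?L
  have ob: "obj Fh X = obj F X" if "X \<in> Ob C" for X
    using L that by (auto simp: functor_eq_def functor_comp_def)
  have lf: "mor Fh (mor (loc C) f) = mor F f" if "f \<in> Mor C" for f
    using L that by (auto simp: functor_eq_def functor_comp_def)
  have fc: "mor Fh (x \<cdot>\<^bsub>Frac C\<^esub> y) = mor Fh x \<cdot>\<^bsub>D\<^esub> mor Fh y" if "composable (Frac C) x y" for x y
    using L that by (simp add: is_functor_def)
  have "mor Fh (dfrac C b f a) = frac_value (b, f, a)" if t: "(b, f, a) \<in> three_arrows C" for b f a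
  proof -
    let ?x = "dfrac C b f a" and ?y = "dfrac C (ident C (src C b)) f a"
    have "is_composite (ident C (src C b), b, ident C (tgt C b)) (ident C (src C b) \<cdot> b, f, a) ?y"
      using t by (intro is_composite_loc_left) simp_all
    then have xy: "mor (loc C) b \<cdot>\<^bsub>Frac C\<^esub> ?x = ?y" using cmp_Frac t by (fastforce simp: mor_loc)
    have "is_composite (ident C (src C b), f, a \<cdot> ident C (tgt C a)) (ident C (src C a), a, ident C (tgt C a))
        (dfrac C (ident C (src C b)) f (ident C (tgt C a)))"
      using t by (intro is_composite_loc_right) simp_all
    then have yf: "?y \<cdot>\<^bsub>Frac C\<^esub> mor (loc C) a = mor (loc C) f"
      using cmp_Frac t by (fastforce simp: mor_loc)
    have xb: "mor F b \<cdot>\<^bsub>D\<^esub> mor Fh ?x = mor Fh ?y"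
      unfolding xy[symmetric] using t by (subst fc) (simp_all add: composable_def lf, simp add: mor_loc)
    have ya: "mor Fh ?y \<cdot>\<^bsub>D\<^esub> mor F a = mor F f"
      using t yf fc[of ?y "mor (loc C) a"] lf by (simp add: composable_def) (simp add: mor_loc)
    have xh: "mor Fh ?x \<in> hom D (obj F (tgt C b)) (obj F (src C a))"
    proof -
      have "mor Fh ?x \<in> hom D (obj Fh (src (Frac C) ?x)) (obj Fh (tgt (Frac C) ?x))"
        using L dfrac_Mor[OF t] unfolding is_functor_def by blast
      then show ?thesis unfolding src_Frac[OF t] tgt_Frac[OF t] using t by (simp add: ob)
    qed
    show ?thesis
      unfolding frac_value_def prod.case ya[symmetric] xb[symmetric] using t xh by (simp add: hom_def)
  qed
  then show ?R using ob by simp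
next
  assume R: ?R
  then have v: "mor Fh (dfrac C b f a) = frac_value (b, f, a)" if "(b, f, a) \<in> three_arrows C" for b f a
    using that by blast
  have vh: "frac_value (b, f, a) \<in> hom D (obj F (tgt C b)) (obj F (src C a))"
    if "(b, f, a) \<in> three_arrows C" for b f a
    using that by (simp add: frac_value_def hom_def)
  have "is_functor (Frac C) D Fh"
    unfolding is_functor_def
  proof (intro conjI ballI allI impI)
    fix x assume "x \<in> Mor (Frac C)"
    then obtain b f a where x: "(b, f, a) \<in> three_arrows C" "x = dfrac C b f a" by (rule Mor_FracE)
    have "tgt C b \<in> Ob C" "src C a \<in> Ob C" using x(1) by simp_all
    then show "mor Fh x \<in> hom D (obj Fh (src (Frac C) x)) (obj Fh (tgt (Frac C) x))"
      unfolding x(2) src_Frac[OF x(1)] tgt_Frac[OF x(1)] v[OF x(1)] using vh[OF x(1)] R by simp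
  next
    fix x y assume "composable (Frac C) x y"
    then obtain b1 f1 a1 b2 f2 a2 where xy: "(b1, f1, a1) \<in> three_arrows C" "x = dfrac C b1 f1 a1"
        "(b2, f2, a2) \<in> three_arrows C" "y = dfrac C b2 f2 a2" "tgt (Frac C) x = src (Frac C) y"
      unfolding composable_def by (elim conjE Mor_FracE)
    have "src C a1 = tgt C b2"
      using xy(5) unfolding xy(2,4) src_Frac[OF xy(3)] tgt_Frac[OF xy(1)] .
    then obtain j j' q q' g1 g2 where ch: "composite_choice b1 f1 a1 b2 f2 a2 j j' q q' g1 g2"
      by (rule composite_choice_exists[OF xy(1,3)])
    note A = composite_choiceD[OF ch]
    have "(q' \<cdot> b1, g1 \<cdot> g2, a2 \<cdot> j') \<in> three_arrows C" by (simp add: A)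
    then show "mor Fh (x \<cdot>\<^bsub>Frac C\<^esub> y) = mor Fh x \<cdot>\<^bsub>D\<^esub> mor Fh y"
      unfolding xy(2,4) cmp_Frac[OF is_compositeI[OF ch HOL.refl]] v[OF xy(1)] v[OF xy(3)]
        frac_value_composite[OF ch, symmetric] by (rule v)
  next
    fix X assume "X \<in> Ob (Frac C)"
    then show "mor Fh (ident (Frac C) X) = ident D (obj Fh X)"
      using R by (simp add: v frac_value_def)
  qed (use R in \<open>simp_all add: category_Frac D.category_axioms\<close>)
  moreover have "functor_eq C F (functor_comp Fh (loc C))"
    using R by (simp add: functor_eq_def functor_comp_def mor_loc v frac_value_def)
  ultimately show ?L by simp
qed

text \<open>A value on a class is read off an arbitrary member picked by \<open>SOME\<close>;
  \<open>frac_value_cong\<close> makes the pick irrelevant.\<close>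

lemma extension_exists:
  obtains Fh where "is_functor (Frac C) D Fh" "functor_eq C F (functor_comp Fh (loc C))"
proof -
  define Fh where "Fh = \<lparr>obj = obj F, mor = \<lambda>x. frac_value (SOME t. t \<in> x)\<rparr>"
  have "mor Fh (dfrac C b f a) = frac_value (b, f, a)" if "(b, f, a) \<in> three_arrows C" for b f a
  proof -
    have "(b, f, a) \<in> dfrac C b f a"
      unfolding dfrac_def using fraction_eq.refl[OF that] by simp
    then have "(SOME t. t \<in> dfrac C b f a) \<in> dfrac C b f a" by (rule someI)
    then have "((b, f, a), SOME t. t \<in> dfrac C b f a) \<in> fraction_eq C" unfolding dfrac_def by simp
    from frac_value_cong[OF this] show ?thesis by (simp add: Fh_def)
  qed
  moreover have "\<forall>X \<in> Ob C. obj Fh X = obj F X" by (simp add: Fh_def)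
  ultimately show thesis using extension_iff[of Fh] that by blast
qed

lemma extension_unique:
  assumes "is_functor (Frac C) D H" "functor_eq C F (functor_comp H (loc C))"
    "is_functor (Frac C) D Fh" "functor_eq C F (functor_comp Fh (loc C))"
  shows "functor_eq (Frac C) H Fh"
  using extension_iff[of H] extension_iff[of Fh] assms
  by (auto simp: functor_eq_def simp del: three_arrows_iff elim!: Mor_FracE)

end

text \<open>\<open>loc C\<close> is the identity on objects, so the components are prescribed.
  Naturality at a double fraction is put together from naturality at \<open>b\<close>,
  \<open>f\<close> and \<open>a\<close>, inverted at the two denominators by
  \<open>inv_mor_swap\<close>.\<close>

lemma (in uni_fractionable) nat_trans_extension_iff:
  fixes D :: "('p, 'n, 'y) category_scheme"
  assumes F: "is_functor C D F" "inverts (Den C) D F" and G: "is_functor C D G" "inverts (Den C) D G"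
    and Fh: "is_functor (Frac C) D Fh" "functor_eq C F (functor_comp Fh (loc C))"
    and Gh: "is_functor (Frac C) D Gh" "functor_eq C G (functor_comp Gh (loc C))"
    and \<alpha>: "nat_trans C D F G \<alpha>"
  shows "nat_trans (Frac C) D Fh Gh \<alpha>h \<and> (\<forall>X \<in> Ob C. \<alpha> X = \<alpha>h (obj (loc C) X)) \<longleftrightarrow>
    (\<forall>X \<in> Ob (Frac C). \<alpha>h X = \<alpha> X)"
proof
  assume eq: "\<forall>X \<in> Ob (Frac C). \<alpha>h X = \<alpha> X"
  interpret D: category D using F by (simp add: is_functor_def)
  interpret F: inverting_functor C D F by unfold_locales (use F in auto)
  interpret G: inverting_functor C D G by unfold_locales (use G in auto)
  have Fh': "\<And>X. X \<in> Ob C \<Longrightarrow> obj Fh X = obj F X"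
    "\<And>b f a. (b, f, a) \<in> three_arrows C \<Longrightarrow> mor Fh (dfrac C b f a) = F.frac_value (b, f, a)"
    using F.extension_iff[of Fh] Fh by blast+
  have Gh': "\<And>X. X \<in> Ob C \<Longrightarrow> obj Gh X = obj G X"
    "\<And>b f a. (b, f, a) \<in> three_arrows C \<Longrightarrow> mor Gh (dfrac C b f a) = G.frac_value (b, f, a)"
    using G.extension_iff[of Gh] Gh by blast+
  have \<alpha>_simps: "\<alpha> X \<in> Mor D" "src D (\<alpha> X) = obj F X" "tgt D (\<alpha> X) = obj G X" if "X \<in> Ob C" for X
    using \<alpha> that by (auto simp: nat_trans_def hom_def)
  have nat: "\<alpha> (src C f) \<cdot>\<^bsub>D\<^esub> mor G f = mor F f \<cdot>\<^bsub>D\<^esub> \<alpha> (tgt C f)" if "f \<in> Mor C" for f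
    using \<alpha> that by (simp add: nat_trans_def)
  have swap: "inv_mor D (mor F d) \<cdot>\<^bsub>D\<^esub> \<alpha> (src C d) = \<alpha> (tgt C d) \<cdot>\<^bsub>D\<^esub> inv_mor D (mor G d)"
    if "d \<in> Den C" for d
    using that nat[of d] by (intro D.inv_mor_swap) (simp_all add: \<alpha>_simps)
  have "mor Fh x \<cdot>\<^bsub>D\<^esub> \<alpha>h (tgt (Frac C) x) = \<alpha>h (src (Frac C) x) \<cdot>\<^bsub>D\<^esub> mor Gh x"
    if x_Mor: "x \<in> Mor (Frac C)" for x
  proof -
    obtain b f a where x: "(b, f, a) \<in> three_arrows C" "x = dfrac C b f a"
      using x_Mor by (rule Mor_FracE)
    let ?i = "\<lambda>F d. inv_mor D (mor F d)"
    have t: "b \<in> Den C" "f \<in> Mor C" "a \<in> Den C" "src C f = src C b" "tgt C f = tgt C a"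
      using x(1) by simp_all
    have "F.frac_value (b, f, a) \<cdot>\<^bsub>D\<^esub> \<alpha> (src C a) = ?i F b \<cdot>\<^bsub>D\<^esub> (mor F f \<cdot>\<^bsub>D\<^esub> (?i F a \<cdot>\<^bsub>D\<^esub> \<alpha> (src C a)))"
      by (simp add: F.frac_value_def t \<alpha>_simps)
    also have "\<dots> = ?i F b \<cdot>\<^bsub>D\<^esub> ((mor F f \<cdot>\<^bsub>D\<^esub> \<alpha> (tgt C f)) \<cdot>\<^bsub>D\<^esub> ?i G a)"
      unfolding swap[OF t(3)] by (simp add: t \<alpha>_simps)
    also have "\<dots> = (?i F b \<cdot>\<^bsub>D\<^esub> \<alpha> (src C b)) \<cdot>\<^bsub>D\<^esub> (mor G f \<cdot>\<^bsub>D\<^esub> ?i G a)"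
      unfolding nat[OF t(2), symmetric] by (simp add: t \<alpha>_simps)
    also have "\<dots> = \<alpha> (tgt C b) \<cdot>\<^bsub>D\<^esub> G.frac_value (b, f, a)"
      unfolding swap[OF t(1)] by (simp add: G.frac_value_def t \<alpha>_simps)
    finally show ?thesis
      unfolding x(2) src_Frac[OF x(1)] tgt_Frac[OF x(1)] Fh'(2)[OF x(1)] Gh'(2)[OF x(1)]
      using eq t by simp
  qed
  then show "nat_trans (Frac C) D Fh Gh \<alpha>h \<and> (\<forall>X \<in> Ob C. \<alpha> X = \<alpha>h (obj (loc C) X))"
    using eq \<alpha> Fh(1) Gh(1) by (simp add: nat_trans_def Fh' Gh')
qed auto

lemma (in uni_fractionable) is_localisation_Frac:
  "is_localisation TYPE('p \<times> 'n) C (Den C) (Frac C) (loc C)"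
  unfolding is_localisation_def
proof (intro conjI allI impI; (elim conjE)?)
  show "Den C \<subseteq> Mor C" by auto
  show "inverts (Den C) (Frac C) (loc C)"
    using is_inverse_loc by (auto simp: inverts_def invertible_def)
next
  fix D :: "('p, 'n) category" and F
  assume F: "is_functor C D F" "inverts (Den C) D F"
  then interpret inverting_functor C D F
    by (intro inverting_functor.intro inverting_functor_axioms.intro uni_fractionable_axioms)
      (simp add: is_functor_def)
  obtain Fh where "is_functor (Frac C) D Fh" "functor_eq C F (functor_comp Fh (loc C))"
    by (rule extension_exists)
  then show "\<exists>Fh. is_functor (Frac C) D Fh \<and> functor_eq C F (functor_comp Fh (loc C)) \<and>
      (\<forall>H. is_functor (Frac C) D H \<and> functor_eq C F (functor_comp H (loc C)) \<longrightarrow> functor_eq (Frac C) H Fh)"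
    using extension_unique by blast
next
  fix D :: "('p, 'n) category" and F G Fh Gh \<alpha>
  assume "is_functor C D F" "inverts (Den C) D F" "is_functor C D G" "inverts (Den C) D G"
    "is_functor (Frac C) D Fh" "functor_eq C F (functor_comp Fh (loc C))"
    "is_functor (Frac C) D Gh" "functor_eq C G (functor_comp Gh (loc C))" "nat_trans C D F G \<alpha>"
  note iff = nat_trans_extension_iff[OF this]
  show "\<exists>\<alpha>h. nat_trans (Frac C) D Fh Gh \<alpha>h \<and> (\<forall>X \<in> Ob C. \<alpha>h (obj (loc C) X) = \<alpha> X) \<and>
      (\<forall>\<beta>. nat_trans (Frac C) D Fh Gh \<beta> \<and> (\<forall>X \<in> Ob C. \<beta> (obj (loc C) X) = \<alpha> X) \<longrightarrow>
        (\<forall>Z \<in> Ob (Frac C). \<beta> Z = \<alpha>h Z))"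
    using iff[of \<alpha>] by (intro exI[of _ \<alpha>]) auto
qed (fact is_functor_loc)

subsection \<open>Morphisms of 3-arrows and the 3-arrow calculus\<close>

context uni_fractionable
begin

text \<open>The outer maps \<open>w\<close>, \<open>w'\<close> act on source and target of the
  3-arrow, the inner maps \<open>u\<close>, \<open>v\<close> on its two middle objects. The grid of
  part (c) consists of three such morphisms, with outer maps \<open>p1, p2\<close>, then
  \<open>g1, g2\<close>, then \<open>i1, i2\<close>.\<close>

fun three_arrow_mor :: "'m \<times> 'm \<times> 'm \<Rightarrow> 'm \<Rightarrow> 'm \<Rightarrow> 'm \<Rightarrow> 'm \<Rightarrow> 'm \<times> 'm \<times> 'm \<Rightarrow> bool" where
  "three_arrow_mor (b, f, a) w u v w' (b', f', a') \<longleftrightarrow>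
     (b, f, a) \<in> three_arrows C \<and> (b', f', a') \<in> three_arrows C \<and>
     commutes C b w u b' \<and> commutes C f v u f' \<and> commutes C a v w' a'"

declare three_arrow_mor.simps [simp del]

lemma three_arrow_morD:
  assumes "three_arrow_mor (b, f, a) w u v w' (b', f', a')"
  shows "b \<in> Den C" "f \<in> Mor C" "a \<in> Den C" "b' \<in> Den C" "f' \<in> Mor C" "a' \<in> Den C"
    "src C f = src C b" "tgt C f = tgt C a" "src C f' = src C b'" "tgt C f' = tgt C a'"
    "w \<in> Mor C" "u \<in> Mor C" "v \<in> Mor C" "w' \<in> Mor C"
    "src C w = tgt C b" "tgt C w = tgt C b'" "src C u = src C b" "tgt C u = src C b'"
    "src C v = tgt C a" "tgt C v = tgt C a'" "src C w' = src C a" "tgt C w' = src C a'"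
    "b \<cdot> w = u \<cdot> b'" "f \<cdot> v = u \<cdot> f'" "a \<cdot> v = w' \<cdot> a'"
proof -
  have c: "commutes C b w u b'" "commutes C f v u f'" "commutes C a v w' a'"
    and t: "(b, f, a) \<in> three_arrows C" "(b', f', a') \<in> three_arrows C"
    using assms by (simp_all add: three_arrow_mor.simps del: three_arrows_iff)
  note D = c[THEN commutesD(1)] c[THEN commutesD(2)] and c' = c[unfolded commutes_iff]
    and t' = t[unfolded three_arrows_iff]
  show "b \<in> Den C" "f \<in> Mor C" "a \<in> Den C" "b' \<in> Den C" "f' \<in> Mor C" "a' \<in> Den C"
    "src C f = src C b" "tgt C f = tgt C a" "src C f' = src C b'" "tgt C f' = tgt C a'"
    "w \<in> Mor C" "u \<in> Mor C" "v \<in> Mor C" "w' \<in> Mor C"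
    "src C w = tgt C b" "tgt C w = tgt C b'" "src C u = src C b" "tgt C u = src C b'"
    "src C v = tgt C a" "tgt C v = tgt C a'" "src C w' = src C a" "tgt C w' = src C a'"
    "b \<cdot> w = u \<cdot> b'" "f \<cdot> v = u \<cdot> f'" "a \<cdot> v = w' \<cdot> a'"
    using D c' t' by auto
qed

lemma three_arrow_morI:
  assumes "b \<in> Den C" "f \<in> Mor C" "a \<in> Den C" "b' \<in> Den C" "f' \<in> Mor C" "a' \<in> Den C"
    "src C f = src C b" "tgt C f = tgt C a" "src C f' = src C b'" "tgt C f' = tgt C a'"
    "w \<in> Mor C" "u \<in> Mor C" "v \<in> Mor C" "w' \<in> Mor C"
    "src C w = tgt C b" "tgt C u = src C b'" "src C v = tgt C a" "tgt C w' = src C a'"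
    "b \<cdot> w = u \<cdot> b'" "f \<cdot> v = u \<cdot> f'" "a \<cdot> v = w' \<cdot> a'"
  shows "three_arrow_mor (b, f, a) w u v w' (b', f', a')"
  using assms by (simp add: three_arrow_mor.simps commutes_iff)

lemma three_arrow_mor_cmp:
  assumes "three_arrow_mor (b, f, a) w u v w' (b', f', a')"
    and "three_arrow_mor (b', f', a') x y z x' (b'', f'', a'')"
  shows "three_arrow_mor (b, f, a) (w \<cdot> x) (u \<cdot> y) (v \<cdot> z) (w' \<cdot> x') (b'', f'', a'')"
proof -
  note A = three_arrow_morD[OF assms(1)] and B = three_arrow_morD[OF assms(2)]
  note X = cmp_eq_extend[OF A(23)] cmp_eq_extend[OF A(24)] cmp_eq_extend[OF A(25)]
  show ?thesis
    by (rule three_arrow_morI) (simp_all add: A(1-22) B(1-25) X)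
qed

text \<open>A right expansion by \<open>c\<close> is such a map from the original 3-arrow
  (\<open>u\<close> an identity, \<open>v = c\<close>), a left expansion one into the original
  (\<open>u = c\<close>, \<open>v\<close> an identity). Both generators of fraction equality are
  thus covered by one notion.\<close>

definition map_over_ident :: "'m \<times> 'm \<times> 'm \<Rightarrow> 'm \<Rightarrow> 'm \<Rightarrow> 'm \<times> 'm \<times> 'm \<Rightarrow> bool" where
  "map_over_ident s u v t \<longleftrightarrow>
     three_arrow_mor s (ident C (tgt C (fst s))) u v (ident C (src C (snd (snd s)))) t"

text \<open>\<open>u\<close> and \<open>v\<close> are denominators although the definition asks only
  for morphisms: \<open>u \<cdot> b' = b\<close> and \<open>a \<cdot> v = a'\<close> permit
  cancellation.\<close>

lemma map_over_identD:
  assumes "map_over_ident (b, f, a) u v (b', f', a')"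
  shows "b \<in> Den C" "f \<in> Mor C" "a \<in> Den C" "b' \<in> Den C" "f' \<in> Mor C" "a' \<in> Den C"
    "src C f = src C b" "tgt C f = tgt C a" "src C f' = src C b'" "tgt C f' = tgt C a'"
    "u \<in> Den C" "v \<in> Den C" "tgt C b' = tgt C b" "src C a' = src C a"
    "src C u = src C b" "tgt C u = src C b'" "src C v = tgt C a" "tgt C v = tgt C a'"
    "u \<cdot> b' = b" "f \<cdot> v = u \<cdot> f'" "a \<cdot> v = a'"
proof -
  note A = three_arrow_morD[OF assms[unfolded map_over_ident_def fst_conv snd_conv]]
  have ends: "tgt C b' = tgt C b" "src C a' = src C a" using A(1,3,16,22) by simp_all
  have e: "u \<cdot> b' = b" "a \<cdot> v = a'" using A(1,23) A(6,25) ends by simp_all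
  have den: "u \<in> Den C" "v \<in> Den C"
    using Den_cancel_right[of b' u] Den_cancel_left[of a v] by (simp_all add: A(1-22) e)
  show "b \<in> Den C" "f \<in> Mor C" "a \<in> Den C" "b' \<in> Den C" "f' \<in> Mor C" "a' \<in> Den C"
    "src C f = src C b" "tgt C f = tgt C a" "src C f' = src C b'" "tgt C f' = tgt C a'"
    "u \<in> Den C" "v \<in> Den C" "tgt C b' = tgt C b" "src C a' = src C a"
    "src C u = src C b" "tgt C u = src C b'" "src C v = tgt C a" "tgt C v = tgt C a'"
    "u \<cdot> b' = b" "f \<cdot> v = u \<cdot> f'" "a \<cdot> v = a'"
    by (fact A ends e den)+
qed

lemma map_over_identI:
  assumes "b \<in> Den C" "f \<in> Mor C" "a \<in> Den C" "b' \<in> Den C" "f' \<in> Mor C" "a' \<in> Den C"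
    "src C f = src C b" "tgt C f = tgt C a" "src C f' = src C b'" "tgt C f' = tgt C a'"
    "u \<in> Mor C" "v \<in> Mor C" "tgt C b' = tgt C b" "src C a' = src C a"
    "tgt C u = src C b'" "src C v = tgt C a"
    "u \<cdot> b' = b" "f \<cdot> v = u \<cdot> f'" "a \<cdot> v = a'"
  shows "map_over_ident (b, f, a) u v (b', f', a')"
  unfolding map_over_ident_def fst_conv snd_conv
  by (rule three_arrow_morI) (simp_all add: assms)

lemma map_over_ident_cmp:
  assumes "map_over_ident (b, f, a) u v (b', f', a')" "map_over_ident (b', f', a') y z (b'', f'', a'')"
  shows "map_over_ident (b, f, a) (u \<cdot> y) (v \<cdot> z) (b'', f'', a'')"
  using three_arrow_mor_cmp[OF assms[unfolded map_over_ident_def fst_conv snd_conv]]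
    map_over_identD(1,3,13,14)[OF assms(1)]
  by (simp add: map_over_ident_def)

text \<open>The inner objects are pulled back separately, \<open>p\<close> along \<open>u\<close>
  and \<open>q\<close> along \<open>v\<close>. The left denominator is the composite
  \<open>p' \<cdot> b\<close>; the numerator \<open>R\<close> and the right denominator
  \<open>Q\<close> are induced by the weak pullback at \<open>v\<close>, and \<open>Q\<close> is a
  denominator because \<open>Q \<cdot> q' = a\<close>. The outer maps remain unchanged.\<close>

lemma three_arrow_mor_pullback:
  assumes "three_arrow_mor (b, f, a) w u v w' (b', f', a')"
    and "map_over_ident (b'', f'', a'') p q (b', f', a')"
    and T: "p \<in> TDen C" "q \<in> TDen C"
  obtains B F A p' q' u' v' where "map_over_ident (B, F, A) p' q' (b, f, a)"
    "p' \<in> TDen C" "q' \<in> TDen C" "three_arrow_mor (B, F, A) w u' v' w' (b'', f'', a'')"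
proof -
  note A = three_arrow_morD[OF assms(1)] and B = map_over_identD[OF assms(2)]
  obtain p' u' where p': "p' \<in> TDen C" "u' \<in> Mor C" "tgt C u' = src C p" "tgt C p' = src C b"
      "src C u' = src C p'" "u' \<cdot> p = p' \<cdot> u"
    by (rule TDen_pullback[of p u]) (auto simp: A B T)
  obtain q' v' where q': "q' \<in> TDen C" "v' \<in> Mor C" "tgt C v' = src C q" "tgt C q' = tgt C a"
      "src C v' = src C q'" "v' \<cdot> q = q' \<cdot> v"
    and ex: "\<And>h k. \<lbrakk>h \<in> Mor C; k \<in> Mor C; tgt C h = src C q; tgt C k = src C v; h \<cdot> q = k \<cdot> v\<rbrakk> \<Longrightarrow>
       \<exists>u. u \<in> Mor C \<and> tgt C u = src C q' \<and> src C u = src C h \<and> u \<cdot> v' = h \<and> u \<cdot> q' = k"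
    by (rule TDen_pullback[of q v]) (auto simp: A B T)
  have "(w' \<cdot> a'') \<cdot> q = a \<cdot> v" by (simp add: A B)
  then obtain Q where Q: "Q \<in> Mor C" "tgt C Q = src C q'" "src C Q = src C a"
      "Q \<cdot> v' = w' \<cdot> a''" "Q \<cdot> q' = a"
    using ex[of "w' \<cdot> a''" a] by (auto simp: A(1-22) B(1-18))
  have "(u' \<cdot> f'') \<cdot> q = p' \<cdot> (u \<cdot> f')"
    by (simp add: A(1-22) B(1-18) B(20) p'(1-5) cmp_eq_extend[OF p'(6)])
  then have "(u' \<cdot> f'') \<cdot> q = (p' \<cdot> f) \<cdot> v" by (simp add: A B(1-18) p'(1-5))
  then obtain R where R: "R \<in> Mor C" "tgt C R = src C q'" "src C R = src C p'"
      "R \<cdot> v' = u' \<cdot> f''" "R \<cdot> q' = p' \<cdot> f"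
    using ex[of "u' \<cdot> f''" "p' \<cdot> f"] p'(1-5) by (auto simp: A(1-22) B(1-18))
  have "Q \<in> Den C" using Den_cancel_right[of q' Q] by (simp add: q' Q A)
  note N = A(1-22) B(1-18) p'(1-5) q'(1-5) Q R this
  have e: "p' \<cdot> (b \<cdot> w) = u' \<cdot> b''"
    unfolding A(23) by (simp add: N B(19) flip: cmp_eq_extend[OF p'(6)])
  show thesis
  proof (rule that)
    show "map_over_ident (p' \<cdot> b, R, Q) p' q' (b, f, a)"
      by (rule map_over_identI) (simp_all add: N)
    show "three_arrow_mor (p' \<cdot> b, R, Q) w u' v' w' (b'', f'', a'')"
      by (rule three_arrow_morI) (simp_all add: N e)
  qed (fact p'(1) q'(1))+
qed

text \<open>Dual to the pullback: the right denominator is now the composite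
  \<open>a \<cdot> j'\<close>, while the left denominator \<open>Q\<close> and the numerator
  \<open>R\<close> are induced by the weak pushout at \<open>u\<close>.\<close>

lemma three_arrow_mor_pushout:
  assumes "three_arrow_mor (b', f', a') w u v w' (b, f, a)"
    and "map_over_ident (b', f', a') i j (b'', f'', a'')"
    and S: "i \<in> SDen C" "j \<in> SDen C"
  obtains B F A i' j' u' v' where "map_over_ident (b, f, a) i' j' (B, F, A)"
    "i' \<in> SDen C" "j' \<in> SDen C" "three_arrow_mor (b'', f'', a'') w u' v' w' (B, F, A)"
proof -
  note A = three_arrow_morD[OF assms(1)] and B = map_over_identD[OF assms(2)]
  obtain j' v' where j': "j' \<in> SDen C" "v' \<in> Mor C" "src C v' = tgt C j" "src C j' = tgt C a"
      "tgt C v' = tgt C j'" "j \<cdot> v' = v \<cdot> j'"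
    by (rule SDen_pushout[of j v]) (auto simp: A B S)
  obtain i' u' where i': "i' \<in> SDen C" "u' \<in> Mor C" "src C u' = tgt C i" "src C i' = src C b"
      "tgt C u' = tgt C i'" "i \<cdot> u' = u \<cdot> i'"
    and ex: "\<And>h k. \<lbrakk>h \<in> Mor C; k \<in> Mor C; src C h = tgt C i; src C k = tgt C u; i \<cdot> h = u \<cdot> k\<rbrakk> \<Longrightarrow>
       \<exists>x. x \<in> Mor C \<and> src C x = tgt C i' \<and> tgt C x = tgt C h \<and> u' \<cdot> x = h \<and> i' \<cdot> x = k"
    by (rule SDen_pushout[of i u]) (auto simp: A B S)
  have "(i \<cdot> b'') \<cdot> w = u \<cdot> b" using A(23) by (simp only: B(19))
  then have "i \<cdot> (b'' \<cdot> w) = u \<cdot> b" by (simp add: A(1-22) B(1-18))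
  then obtain Q where Q: "Q \<in> Mor C" "src C Q = tgt C i'" "tgt C Q = tgt C b"
      "u' \<cdot> Q = b'' \<cdot> w" "i' \<cdot> Q = b"
    using ex[of "b'' \<cdot> w" b] by (auto simp: A(1-22) B(1-18))
  have "i \<cdot> (f'' \<cdot> v') = f' \<cdot> (j \<cdot> v')"
    by (simp add: A(1-22) B(1-18) j'(1-5) cmp_eq_extend[OF B(20)])
  then have "i \<cdot> (f'' \<cdot> v') = u \<cdot> (f \<cdot> j')"
    unfolding j'(6) by (simp add: A(1-22) B(1-18) j'(1-5) cmp_eq_extend[OF A(24)])
  then obtain R where R: "R \<in> Mor C" "src C R = tgt C i'" "tgt C R = tgt C j'"
      "u' \<cdot> R = f'' \<cdot> v'" "i' \<cdot> R = f \<cdot> j'"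
    using ex[of "f'' \<cdot> v'" "f \<cdot> j'"] j'(1-5) by (auto simp: A(1-22) B(1-18))
  have "Q \<in> Den C" using Den_cancel_left[of i' Q] by (simp add: i' Q A)
  note N = A(1-22) B(1-18) i'(1-5) j'(1-5) Q R this
  have "(a' \<cdot> j) \<cdot> v' = w' \<cdot> (a \<cdot> j')"
    by (simp add: A(1-22) B(1-18) j' cmp_eq_extend[OF A(25)])
  then have e: "a'' \<cdot> v' = w' \<cdot> (a \<cdot> j')" unfolding B(21) .
  show thesis
  proof (rule that)
    show "map_over_ident (b, f, a) i' j' (Q, R, a \<cdot> j')"
      by (rule map_over_identI) (simp_all add: N)
    show "three_arrow_mor (b'', f'', a'') w u' v' w' (Q, R, a \<cdot> j')"
      by (rule three_arrow_morI) (simp_all add: N e)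
  qed (fact i'(1) j'(1))+
qed

text \<open>Since \<open>u\<close> and \<open>v\<close> are denominators,
  \<open>square_factor\<close> applies to the middle square; the intermediate 3-arrow is
  \<open>(p \<cdot> b', h, a \<cdot> j)\<close>.\<close>

lemma map_over_ident_factor:
  assumes "map_over_ident (b, f, a) u v (b', f', a')"
  obtains B F A i j p q where "map_over_ident (b, f, a) i j (B, F, A)" "i \<in> SDen C" "j \<in> SDen C"
    "map_over_ident (B, F, A) p q (b', f', a')" "p \<in> TDen C" "q \<in> TDen C"
proof -
  note A = map_over_identD[OF assms]
  obtain i p j q h where F: "i \<in> SDen C" "p \<in> TDen C" "j \<in> SDen C" "q \<in> TDen C" "h \<in> Mor C"
    "src C i = src C b" "tgt C i = src C p" "tgt C p = src C b'"
    "src C j = tgt C a" "tgt C j = src C q" "tgt C q = tgt C a'"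
    "src C h = src C p" "tgt C h = src C q"
    "i \<cdot> p = u" "j \<cdot> q = v" "i \<cdot> h = f \<cdot> j" "h \<cdot> q = p \<cdot> f'"
    by (rule square_factor[OF _ _ _ _ _ _ _ _ _ _ _ _ A(20)[symmetric], of "src C b" "src C b'" "tgt C a" "tgt C a'"])
      (auto simp: A)
  have e: "i \<cdot> (p \<cdot> b') = b" "a \<cdot> (j \<cdot> q) = a'"
    using A(19,21) by (simp_all add: F(1-13) A(1-18) flip: F(14,15))
  show thesis
  proof (rule that)
    show "map_over_ident (b, f, a) i j (p \<cdot> b', h, a \<cdot> j)"
      by (rule map_over_identI) (simp_all add: F(1-13,16) A(1-18) e)
    show "map_over_ident (p \<cdot> b', h, a \<cdot> j) p q (b', f', a')"
      by (rule map_over_identI) (simp_all add: F(1-13,17) A(1-18) e)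
  qed (fact F)+
qed

section \<open>Zigzags as a normal form of fraction equality\<close>

definition zigzag :: "'m \<times> 'm \<times> 'm \<Rightarrow> 'm \<times> 'm \<times> 'm \<Rightarrow> bool" where
  "zigzag s t \<longleftrightarrow> (\<exists>b f a b' f' a' p q u v i j.
     map_over_ident (b, f, a) p q s \<and> p \<in> TDen C \<and> q \<in> TDen C \<and>
     map_over_ident (b, f, a) u v (b', f', a') \<and>
     map_over_ident t i j (b', f', a') \<and> i \<in> SDen C \<and> j \<in> SDen C)"

lemma zigzag_refl:
  assumes "(b, f, a) \<in> three_arrows C"
  shows "zigzag (b, f, a) (b, f, a)"
proof -
  have "map_over_ident (b, f, a) (ident C (src C b)) (ident C (tgt C a)) (b, f, a)"
    using assms by (intro map_over_identI) simp_all
  moreover have "src C b \<in> Ob C" "tgt C a \<in> Ob C" using assms by simp_all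
  ultimately show ?thesis unfolding zigzag_def by (meson ident_SDen ident_TDen)
qed

text \<open>The last leg is an S-morphism, so it can be pushed out along the new map; the opposite
  side of the pushout prolongs the middle map.\<close>

lemma zigzag_forward:
  assumes z: "zigzag (b1, f1, a1) (b2, f2, a2)"
    and m: "map_over_ident (b2, f2, a2) x y (b3, f3, a3)"
  shows "zigzag (b1, f1, a1) (b3, f3, a3)"
proof -
  obtain b f a b' f' a' p q u v i j where
    1: "map_over_ident (b, f, a) p q (b1, f1, a1)" "p \<in> TDen C" "q \<in> TDen C" and
    2: "map_over_ident (b, f, a) u v (b', f', a')" and
    3: "map_over_ident (b2, f2, a2) i j (b', f', a')" "i \<in> SDen C" "j \<in> SDen C"
    using z unfolding zigzag_def by blast
  obtain B F A i' j' u' v' where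
    4: "map_over_ident (b3, f3, a3) i' j' (B, F, A)" "i' \<in> SDen C" "j' \<in> SDen C" and
    5: "three_arrow_mor (b', f', a') (ident C (tgt C b2)) u' v' (ident C (src C a2)) (B, F, A)"
    by (rule three_arrow_mor_pushout[OF m[unfolded map_over_ident_def fst_conv snd_conv] 3])
  have "map_over_ident (b', f', a') u' v' (B, F, A)"
    using 5 map_over_identD[OF 3(1)] by (simp add: map_over_ident_def)
  with 1 2 4 show ?thesis unfolding zigzag_def by (meson map_over_ident_cmp)
qed

text \<open>The new map followed by the last leg factors into an S- and a T-morphism. The S-part is
  the new last leg; the T-part is pulled back along the middle map and composed with the first leg,
  which remains a T-morphism.\<close>

lemma zigzag_backward:
  assumes z: "zigzag (b1, f1, a1) (b2, f2, a2)"
    and m: "map_over_ident (b3, f3, a3) x y (b2, f2, a2)"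
  shows "zigzag (b1, f1, a1) (b3, f3, a3)"
proof -
  obtain b f a b' f' a' p q u v i j where
    1: "map_over_ident (b, f, a) p q (b1, f1, a1)" "p \<in> TDen C" "q \<in> TDen C" and
    2: "map_over_ident (b, f, a) u v (b', f', a')" and
    3: "map_over_ident (b2, f2, a2) i j (b', f', a')"
    using z unfolding zigzag_def by blast
  obtain B F A k l r s where
    4: "map_over_ident (b3, f3, a3) k l (B, F, A)" "k \<in> SDen C" "l \<in> SDen C" and
    5: "map_over_ident (B, F, A) r s (b', f', a')" "r \<in> TDen C" "s \<in> TDen C"
    by (rule map_over_ident_factor[OF map_over_ident_cmp[OF m 3]])
  obtain B' F' A' r' s' u' v' where
    6: "map_over_ident (B', F', A') r' s' (b, f, a)" "r' \<in> TDen C" "s' \<in> TDen C" and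
    7: "three_arrow_mor (B', F', A') (ident C (tgt C b)) u' v' (ident C (src C a)) (B, F, A)"
    by (rule three_arrow_mor_pullback[OF 2[unfolded map_over_ident_def fst_conv snd_conv] 5])
  have 8: "map_over_ident (B', F', A') u' v' (B, F, A)"
    using 7 map_over_identD[OF 6(1)] by (simp add: map_over_ident_def)
  have 9: "map_over_ident (B', F', A') (r' \<cdot> p) (s' \<cdot> q) (b1, f1, a1)"
    by (rule map_over_ident_cmp[OF 6(1) 1(1)])
  have "r' \<cdot> p \<in> TDen C" "s' \<cdot> q \<in> TDen C"
    using 1(2,3) 6(2,3) map_over_identD[OF 6(1)] map_over_identD[OF 1(1)] by simp_all
  with 9 8 4 show ?thesis unfolding zigzag_def by blast
qed

text \<open>Moving the right end of a zigzag along a fraction equality is formulated as an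
  equivalence, which makes symmetry and transitivity trivial. The start is the zigzag of
  identities.\<close>

lemma fraction_eq_zigzag:
  assumes "((b, f, a), (b', f', a')) \<in> fraction_eq C"
  shows "zigzag (b, f, a) (b', f', a')"
proof -
  have "zigzag r s \<longleftrightarrow> zigzag r t" if "(s, t) \<in> fraction_eq C" for r s t
    using that
  proof (induction rule: fraction_eq.induct)
    case (expand_right b f a c)
    then have "map_over_ident (b, f, a) (ident C (src C b)) c (b, f \<cdot> c, a \<cdot> c)"
      by (intro map_over_identI) (auto simp: composable_def)
    then show ?case by (cases r) (blast intro: zigzag_forward zigzag_backward)
  next
    case (expand_left b f a c)
    then have "map_over_ident (c \<cdot> b, c \<cdot> f, a) c (ident C (tgt C a)) (b, f, a)"
      by (intro map_over_identI) (auto simp: composable_def)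
    then show ?case by (cases r) (blast intro: zigzag_forward zigzag_backward)
  qed auto
  then show ?thesis using assms fraction_eq_dest zigzag_refl by blast
qed

text \<open>Factoring \<open>p2 \<cdot> a = j \<cdot> q\<close> makes the new right denominator
  \<open>j\<close> an S-denominator, so that it can later be pushed out along \<open>g2\<close>. The
  left end is then corrected by pulling \<open>p1\<close> back; \<open>h\<close> is a denominator by
  cancelling \<open>p1\<close>.\<close>

lemma three_arrow_lift_TDen:
  assumes "(b, f, a) \<in> three_arrows C" "p1 \<in> TDen C" "p2 \<in> TDen C" "tgt C p1 = tgt C b" "tgt C p2 = src C a"
  obtains b' f' a' q1 q2 where "three_arrow_mor (b', f', a') p1 q1 q2 p2 (b, f, a)"
    "q1 \<in> TDen C" "q2 \<in> TDen C" "a' \<in> SDen C"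
proof -
  have t: "b \<in> Den C" "f \<in> Mor C" "a \<in> Den C" "src C f = src C b" "tgt C f = tgt C a" using assms(1) by simp_all
  obtain j q where j: "j \<in> SDen C" "q \<in> TDen C" "src C j = src C p2"
      "tgt C j = src C q" "tgt C q = tgt C a" "j \<cdot> q = p2 \<cdot> a"
    by (rule Den_factor[of "p2 \<cdot> a" "src C p2" "tgt C a"]) (auto simp: t assms)
  obtain q' g where q': "q' \<in> TDen C" "g \<in> Mor C" "tgt C g = src C q" "tgt C q' = src C b"
      "src C g = src C q'" "g \<cdot> q = q' \<cdot> f"
    by (rule TDen_pullback[of q f]) (auto simp: t j)
  obtain p h where p: "p \<in> TDen C" "h \<in> Mor C" "tgt C h = src C p1" "tgt C p = src C q'"
      "src C h = src C p" "h \<cdot> p1 = p \<cdot> (q' \<cdot> b)"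
    by (rule TDen_pullback[of p1 "q' \<cdot> b"]) (auto simp: t assms q')
  have "h \<in> Den C" using Den_cancel_right[of p1 h] by (simp add: p q' t assms)
  then have "three_arrow_mor (h, p \<cdot> g, j) p1 (p \<cdot> q') q p2 (b, f, a)"
    by (intro three_arrow_morI) (simp_all add: assms(2-) t j q' p)
  then show thesis by (rule that) (simp_all add: j p q')
qed

text \<open>Dual: factoring \<open>b \<cdot> i1 = k \<cdot> r\<close> gives the T-denominator
  \<open>r\<close> on the left, to be pulled back along \<open>g1\<close>.\<close>

lemma three_arrow_lift_SDen:
  assumes "(b, f, a) \<in> three_arrows C" "i1 \<in> SDen C" "i2 \<in> SDen C" "src C i1 = tgt C b" "src C i2 = src C a"
  obtains b' f' a' j1 j2 where "three_arrow_mor (b, f, a) i1 j1 j2 i2 (b', f', a')"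
    "j1 \<in> SDen C" "j2 \<in> SDen C" "b' \<in> TDen C"
proof -
  have t: "b \<in> Den C" "f \<in> Mor C" "a \<in> Den C" "src C f = src C b" "tgt C f = tgt C a" using assms(1) by simp_all
  obtain k r where k: "k \<in> SDen C" "r \<in> TDen C" "src C k = src C b"
      "tgt C k = src C r" "tgt C r = tgt C i1" "k \<cdot> r = b \<cdot> i1"
    by (rule Den_factor[of "b \<cdot> i1" "src C b" "tgt C i1"]) (auto simp: t assms)
  obtain k' h where k': "k' \<in> SDen C" "h \<in> Mor C" "src C h = tgt C k" "src C k' = tgt C a"
      "tgt C h = tgt C k'" "k \<cdot> h = f \<cdot> k'"
    by (rule SDen_pushout[of k f]) (auto simp: t k)
  obtain j l where l: "j \<in> SDen C" "l \<in> Mor C" "src C l = tgt C i2" "src C j = tgt C k'"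
      "tgt C l = tgt C j" "i2 \<cdot> l = (a \<cdot> k') \<cdot> j"
    by (rule SDen_pushout[of i2 "a \<cdot> k'"]) (auto simp: t assms k')
  have "l \<in> Den C" using Den_cancel_left[of i2 l] by (simp add: l k' t assms)
  moreover have "k \<cdot> (h \<cdot> j) = f \<cdot> (k' \<cdot> j)"
    by (simp add: cmp_eq_extend[OF k'(6)] k(1-5) k'(1-5) l(1-5) t)
  ultimately have "three_arrow_mor (b, f, a) i1 k (k' \<cdot> j) i2 (r, h \<cdot> j, l)"
    by (intro three_arrow_morI) (simp_all add: assms(2-) t k k' l)
  then show thesis by (rule that) (simp_all add: k k' l)
qed

text \<open>Multiply by \<open>loc\<close> of \<open>p\<close> on the left and by \<open>loc\<close>
  of \<open>i\<close> on the right; each product strips one factor.\<close>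

lemma dfrac_cancel:
  assumes "dfrac C (b \<cdot> p) f (i \<cdot> a) = dfrac C (b' \<cdot> p) f' (i \<cdot> a')"
    and t: "(b, f, a) \<in> three_arrows C" "(b', f', a') \<in> three_arrows C" "p \<in> Den C" "i \<in> Den C"
      "tgt C b = src C p" "tgt C b' = src C p" "src C a = tgt C i" "src C a' = tgt C i"
  shows "dfrac C b f a = dfrac C b' f' a'"
proof -
  have l: "dfrac C (ident C (src C p)) p (ident C (tgt C p)) \<cdot>\<^bsub>Frac C\<^esub> dfrac C (b \<cdot> p) f (i \<cdot> a) = dfrac C b f (i \<cdot> a)"
    if "(b, f, a) \<in> three_arrows C" "tgt C b = src C p" "src C a = tgt C i" for b f a
    by (rule cmp_Frac, rule is_composite_loc_left) (use that t(3,4) in simp_all)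
  have r: "dfrac C b f (i \<cdot> a) \<cdot>\<^bsub>Frac C\<^esub> dfrac C (ident C (src C i)) i (ident C (tgt C i)) = dfrac C b f a"
    if "(b, f, a) \<in> three_arrows C" "src C a = tgt C i" for b f a
    by (rule cmp_Frac, rule is_composite_loc_right) (use that t(3,4) in simp_all)
  have "dfrac C b f (i \<cdot> a) = dfrac C b' f' (i \<cdot> a')"
    using l[OF t(1,5,7)] l[OF t(2,6,8)] unfolding assms(1) by (rule HOL.trans[OF HOL.sym])
  then show ?thesis
    using r[OF t(1,7)] r[OF t(2,8)] by (metis (no_types))
qed

lemma normal_three_arrowsD:
  assumes "(p, g, i) \<in> normal_three_arrows C"
  shows "(p, g, i) \<in> three_arrows C" "p \<in> TDen C" "g \<in> Mor C" "i \<in> SDen C"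
    "src C g = src C p" "tgt C g = tgt C i"
  using assms by (auto simp: normal_three_arrows_def)

text \<open>Six of the nine squares form composition choices, over \<open>a1' \<cdot> p2'\<close>
  for one product and over \<open>i1' \<cdot> b2'\<close> for the other. The remaining three equate
  left denominators, numerators and right denominators of the results.\<close>

lemma grid_imp_composites_eq:
  assumes t: "(b1, f1, a1) \<in> three_arrows C" "(b2, f2, a2) \<in> three_arrows C"
      "(b1', f1', a1') \<in> three_arrows C" "(b2', f2', a2') \<in> three_arrows C"
    and n: "(p1, g1, i1) \<in> normal_three_arrows C" "(p2, g2, i2) \<in> normal_three_arrows C"
      "(p1', g1', i1') \<in> normal_three_arrows C" "(p2', g2', i2') \<in> normal_three_arrows C"
    and p: "commutes C b1' p1 p1' b1" "commutes C f1' p2' p1' f1" "commutes C a1' p2' p2 a1"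
    and g: "commutes C b1' g1 g1' b2'" "commutes C f1' g2' g1' f2'" "commutes C a1' g2' g2 a2'"
    and i: "commutes C b2 i1 i1' b2'" "commutes C f2 i2' i1' f2'" "commutes C a2 i2' i2 a2'"
  shows "dfrac C b1 f1 a1 \<cdot>\<^bsub>Frac C\<^esub> dfrac C p2 g2 i2 = dfrac C p1 g1 i1 \<cdot>\<^bsub>Frac C\<^esub> dfrac C b2 f2 a2"
proof -
  have "composite_choice b1 f1 a1 p2 g2 i2 a1' a2' p2' p1' f1' g2'"
    using t n p g by (auto simp: composite_choice_def commutes_iff normal_three_arrows_def)
  from cmp_Frac[OF is_compositeI[OF this HOL.refl]]
  have 1: "dfrac C b1 f1 a1 \<cdot>\<^bsub>Frac C\<^esub> dfrac C p2 g2 i2 = dfrac C (p1' \<cdot> b1) (f1' \<cdot> g2') (i2 \<cdot> a2')" .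
  have "composite_choice p1 g1 i1 b2 f2 a2 i1' i2' b2' b1' g1' f2'"
    using t n g i by (auto simp: composite_choice_def commutes_iff normal_three_arrows_def)
  from cmp_Frac[OF is_compositeI[OF this HOL.refl]]
  have 2: "dfrac C p1 g1 i1 \<cdot>\<^bsub>Frac C\<^esub> dfrac C b2 f2 a2 = dfrac C (b1' \<cdot> p1) (g1' \<cdot> f2') (a2 \<cdot> i2')" .
  show ?thesis unfolding 1 2 using p(1) g(2) i(3) by (simp add: commutes_def)
qed

text \<open>Lift the first 3-arrow along the T-denominators \<open>p1, p2\<close> and the second one along the S-denominators
  \<open>i1, i2\<close>. Pushing the first lift out along \<open>g2\<close> and pulling the second one back along \<open>g1\<close> gives two
  fraction equal 3-arrows; the zigzag between them is then moved back to the lifts.\<close>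

lemma composites_eq_imp_grid:
  assumes t1: "(b1, f1, a1) \<in> three_arrows C" and t2: "(b2, f2, a2) \<in> three_arrows C"
    and n1: "(p1, g1, i1) \<in> normal_three_arrows C" and n2: "(p2, g2, i2) \<in> normal_three_arrows C"
    and ends: "tgt C p1 = tgt C b1" "tgt C p2 = src C a1" "src C i1 = tgt C b2" "src C i2 = src C a2"
    and eq: "dfrac C b1 f1 a1 \<cdot>\<^bsub>Frac C\<^esub> dfrac C p2 g2 i2 = dfrac C p1 g1 i1 \<cdot>\<^bsub>Frac C\<^esub> dfrac C b2 f2 a2"
  shows "\<exists>b1' f1' a1' b2' f2' a2' p1' g1' i1' p2' g2' i2'.
     (b1', f1', a1') \<in> three_arrows C \<and> (b2', f2', a2') \<in> three_arrows C \<and>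
     (p1', g1', i1') \<in> normal_three_arrows C \<and> (p2', g2', i2') \<in> normal_three_arrows C \<and>
     commutes C b1' p1 p1' b1 \<and> commutes C f1' p2' p1' f1 \<and> commutes C a1' p2' p2 a1 \<and>
     commutes C b1' g1 g1' b2' \<and> commutes C f1' g2' g1' f2' \<and> commutes C a1' g2' g2 a2' \<and>
     commutes C b2 i1 i1' b2' \<and> commutes C f2 i2' i1' f2' \<and> commutes C a2 i2' i2 a2'"
proof -
  note N1 = normal_three_arrowsD[OF n1] and N2 = normal_three_arrowsD[OF n2]
  obtain b f j q1 q2 where m1: "three_arrow_mor (b, f, j) p1 q1 q2 p2 (b1, f1, a1)"
    and q: "q1 \<in> TDen C" "q2 \<in> TDen C" and j: "j \<in> SDen C"
    by (rule three_arrow_lift_TDen[OF t1 N1(2) N2(2) ends(1,2)])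
  obtain r h a j1 j2 where m2: "three_arrow_mor (b2, f2, a2) i1 j1 j2 i2 (r, h, a)"
    and jj: "j1 \<in> SDen C" "j2 \<in> SDen C" and r: "r \<in> TDen C"
    by (rule three_arrow_lift_SDen[OF t2 N1(4) N2(4) ends(3,4)])
  note A = three_arrow_morD[OF m1] and B = three_arrow_morD[OF m2]
  obtain j' k where k: "j' \<in> SDen C" "k \<in> Mor C" "src C k = tgt C j" "src C j' = tgt C i2"
      "tgt C k = tgt C j'" "j \<cdot> k = g2 \<cdot> j'"
    by (rule SDen_pushout[of j g2]) (auto simp: A N2(3,5,6) j)
  obtain r' l where l: "r' \<in> TDen C" "l \<in> Mor C" "tgt C l = src C r" "tgt C r' = src C p1"
      "src C l = src C r'" "l \<cdot> r = r' \<cdot> g1"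
    by (rule TDen_pullback[of r g1]) (auto simp: B N1(3,5,6) r)
  \<comment> \<open>\<open>s1\<close> carries \<open>g2\<close> at the right end and
    \<open>s2\<close> carries \<open>g1\<close> at the left end; their other ends are identities. So
    the two outer columns \<open>g1\<close> and \<open>g2\<close> are supplied separately.\<close>
  have s1: "three_arrow_mor (b, f, j) (ident C (tgt C b)) (ident C (src C b)) k g2 (b, f \<cdot> k, j')"
    by (rule three_arrow_morI) (simp_all add: A(1-22) k N2(2-6))
  have s2: "three_arrow_mor (r', l \<cdot> h, a) g1 l (ident C (tgt C a)) (ident C (src C a)) (r, h, a)"
    by (rule three_arrow_morI) (simp_all add: B(1-22) l N1(2-6))
  have "composite_choice b1 f1 a1 p2 g2 i2 j j' q2 q1 f k"
    by (rule composite_choiceI) (simp_all add: A k N2(2-6) ends q j)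
  from cmp_Frac[OF is_compositeI[OF this HOL.refl]]
  have c1: "dfrac C b1 f1 a1 \<cdot>\<^bsub>Frac C\<^esub> dfrac C p2 g2 i2 = dfrac C (b \<cdot> p1) (f \<cdot> k) (i2 \<cdot> j')"
    by (simp only: A(23))
  have "composite_choice p1 g1 i1 b2 f2 a2 j1 j2 r r' l h"
    by (rule composite_choiceI) (simp_all add: B l N1(2-6) ends jj r)
  from cmp_Frac[OF is_compositeI[OF this HOL.refl]]
  have c2: "dfrac C p1 g1 i1 \<cdot>\<^bsub>Frac C\<^esub> dfrac C b2 f2 a2 = dfrac C (r' \<cdot> p1) (l \<cdot> h) (i2 \<cdot> a)"
    by (simp only: B(25))
  have st: "(b, f \<cdot> k, j') \<in> three_arrows C" "(r', l \<cdot> h, a) \<in> three_arrows C"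
    using three_arrow_morD[OF s1] three_arrow_morD[OF s2] by simp_all
  have "dfrac C b (f \<cdot> k) j' = dfrac C r' (l \<cdot> h) a"
    by (rule dfrac_cancel[OF _ st, of p1 i2])
      (simp_all add: A(1-22) B(1-22) k(1-5) l(1-5) N1(2-6) N2(2-6) c1[symmetric] c2[symmetric] eq)
  then have "zigzag (b, f \<cdot> k, j') (r', l \<cdot> h, a)"
    unfolding dfrac_eq_iff[OF st] by (rule fraction_eq_zigzag)
  then obtain x1 x2 x3 y1 y2 y3 \<pi> \<pi>' u v \<iota> \<iota>' where
    x: "map_over_ident (x1, x2, x3) \<pi> \<pi>' (b, f \<cdot> k, j')" "\<pi> \<in> TDen C" "\<pi>' \<in> TDen C" and
    xy: "map_over_ident (x1, x2, x3) u v (y1, y2, y3)" and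
    y: "map_over_ident (r', l \<cdot> h, a) \<iota> \<iota>' (y1, y2, y3)" "\<iota> \<in> SDen C" "\<iota>' \<in> SDen C"
    unfolding zigzag_def by blast
  \<comment> \<open>The T-leg of the zigzag is pulled back along \<open>s1\<close> and the S-leg
    pushed out along \<open>s2\<close>. This replaces the two lifts by refinements over the
    identities, so composition with \<open>m1\<close> and \<open>m2\<close> keeps the outer maps
    \<open>p1, p2\<close> and \<open>i1, i2\<close>.\<close>
  obtain b1' f1' a1' \<rho> \<rho>' u1 v1 where
    T: "map_over_ident (b1', f1', a1') \<rho> \<rho>' (b, f, j)" "\<rho> \<in> TDen C" "\<rho>' \<in> TDen C" and
    tx: "three_arrow_mor (b1', f1', a1') (ident C (tgt C b)) u1 v1 g2 (x1, x2, x3)"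
    by (rule three_arrow_mor_pullback[OF s1 x])
  obtain b2' f2' a2' \<kappa> \<kappa>' u2 v2 where
    S: "map_over_ident (r, h, a) \<kappa> \<kappa>' (b2', f2', a2')" "\<kappa> \<in> SDen C" "\<kappa>' \<in> SDen C" and
    yt: "three_arrow_mor (y1, y2, y3) g1 u2 v2 (ident C (src C a)) (b2', f2', a2')"
    by (rule three_arrow_mor_pushout[OF s2 y])
  have P: "three_arrow_mor (b1', f1', a1') p1 (\<rho> \<cdot> q1) (\<rho>' \<cdot> q2) p2 (b1, f1, a1)"
    using three_arrow_mor_cmp[OF T(1)[unfolded map_over_ident_def fst_conv snd_conv] m1]
      map_over_identD(13,14)[OF T(1)] by (simp add: A(11,14,15,21))
  have I: "three_arrow_mor (b2, f2, a2) i1 (j1 \<cdot> \<kappa>) (j2 \<cdot> \<kappa>') i2 (b2', f2', a2')"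
    using three_arrow_mor_cmp[OF m2 S(1)[unfolded map_over_ident_def fst_conv snd_conv]]
    by (simp add: B(11,14,16,22))
  note X = three_arrow_morD[OF tx] and Y = three_arrow_morD[OF yt]
  \<comment> \<open>The middle part of the grid is the composite of \<open>tx\<close>,
    \<open>xy\<close> and \<open>yt\<close>: only \<open>yt\<close> contributes at the left end,
    namely \<open>g1\<close>, and only \<open>tx\<close> at the right end, namely
    \<open>g2\<close>.\<close>
  have G: "three_arrow_mor (b1', f1', a1') g1 (u1 \<cdot> (u \<cdot> u2)) (v1 \<cdot> (v \<cdot> v2)) g2 (b2', f2', a2')"
    using three_arrow_mor_cmp[OF tx three_arrow_mor_cmp[OF xy[unfolded map_over_ident_def fst_conv snd_conv] yt]]
      X(14,16,22) Y(11,15,21,22) map_over_identD(1,3,13,14)[OF xy]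
      map_over_identD(13,14)[OF x(1)] map_over_identD(13,14)[OF y(1)] N1(3,5) N2(3,6)
      A(15,16,21) l(4) k(4)
    by (simp add: A(1-22))
  note P' = three_arrow_morD[OF P] and I' = three_arrow_morD[OF I] and G' = three_arrow_morD[OF G]
  have "\<rho> \<cdot> q1 \<in> TDen C" "\<rho>' \<cdot> q2 \<in> TDen C" "j1 \<cdot> \<kappa> \<in> SDen C" "j2 \<cdot> \<kappa>' \<in> SDen C"
    using T S q jj map_over_identD(15-18)[OF T(1)] map_over_identD(15-18)[OF S(1)] A(17-20) B(17-20)
    by simp_all
  then have "(\<rho> \<cdot> q1, u1 \<cdot> (u \<cdot> u2), j1 \<cdot> \<kappa>) \<in> normal_three_arrows C"
      "(\<rho>' \<cdot> q2, v1 \<cdot> (v \<cdot> v2), j2 \<cdot> \<kappa>') \<in> normal_three_arrows C"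
    using G'(12,13,17-20) P'(17-20) I'(17-20) by (simp_all add: normal_three_arrows_def)
  with P I G show ?thesis unfolding three_arrow_mor.simps by blast
qed

end

section \<open>The fraction category: composition, universal property and 3-arrow calculus\<close>

theorem theorem5p18:
  fixes C :: "('o, 'm) unifrac_category" (structure)
  assumes "uni_fractionable C"
  shows "\<comment> \<open>(a)\<close>
    category (Frac C) \<and>
    (Ob (Frac C) = Ob C) \<and>
    (Mor (Frac C) = {dfrac C b f a | b f a. (b, f, a) \<in> three_arrows C}) \<and>
    (\<forall>b f a. (b, f, a) \<in> three_arrows C \<longrightarrow>
       src (Frac C) (dfrac C b f a) = tgt C b \<and> tgt (Frac C) (dfrac C b f a) = src C a) \<and>
    (\<forall>b1 f1 a1 b2 f2 a2.
       (b1, f1, a1) \<in> three_arrows C \<and> (b2, f2, a2) \<in> three_arrows C \<and>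
       tgt (Frac C) (dfrac C b1 f1 a1) = src (Frac C) (dfrac C b2 f2 a2) \<longrightarrow>
       (\<exists>d d' e e' g1 g2. d \<in> Den C \<and> d' \<in> Den C \<and> e \<in> Den C \<and> e' \<in> Den C \<and>
          commutes C b2 a1 d e \<and> commutes C g1 e e' f1 \<and> commutes C d g2 f2 d') \<and>
       (\<forall>d d' e e' g1 g2. d \<in> Den C \<and> d' \<in> Den C \<and> e \<in> Den C \<and> e' \<in> Den C \<and>
          commutes C b2 a1 d e \<and> commutes C g1 e e' f1 \<and> commutes C d g2 f2 d' \<longrightarrow>
          dfrac C b1 f1 a1 \<cdot>\<^bsub>Frac C\<^esub> dfrac C b2 f2 a2 = dfrac C (e' \<cdot> b1) (g1 \<cdot> g2) (a2 \<cdot> d'))) \<and>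
    (\<forall>X \<in> Ob C. ident (Frac C) X = dfrac C (ident C X) (ident C X) (ident C X)) \<and>
    \<comment> \<open>(b)\<close>
    is_localisation TYPE('p \<times> 'n) C (Den C) (Frac C) (loc C) \<and>
    (\<forall>X \<in> Ob C. obj (loc C) X = X) \<and>
    (\<forall>f \<in> Mor C. mor (loc C) f = dfrac C (ident C (src C f)) f (ident C (tgt C f))) \<and>
    (\<forall>d \<in> Den C.
       inv_mor (Frac C) (mor (loc C) d) = dfrac C d (ident C (src C d)) (ident C (src C d)) \<and>
       dfrac C d (ident C (src C d)) (ident C (src C d))
         = dfrac C (ident C (tgt C d)) (ident C (tgt C d)) d) \<and>
    (\<forall>(D :: ('p, 'n) category) F Fh.
       is_functor C D F \<and> inverts (Den C) D F \<longrightarrow>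
       (is_functor (Frac C) D Fh \<and> functor_eq C F (functor_comp Fh (loc C))
          \<longleftrightarrow> (\<forall>X \<in> Ob C. obj Fh X = obj F X) \<and>
              (\<forall>b f a. (b, f, a) \<in> three_arrows C \<longrightarrow>
                 mor Fh (dfrac C b f a)
                   = inv_mor D (mor F b) \<cdot>\<^bsub>D\<^esub> mor F f \<cdot>\<^bsub>D\<^esub> inv_mor D (mor F a)))) \<and>
    (\<forall>(D :: ('p, 'n) category) F G Fh Gh \<alpha> \<alpha>h.
       is_functor C D F \<and> inverts (Den C) D F \<and> is_functor C D G \<and> inverts (Den C) D G \<and>
       is_functor (Frac C) D Fh \<and> functor_eq C F (functor_comp Fh (loc C)) \<and>
       is_functor (Frac C) D Gh \<and> functor_eq C G (functor_comp Gh (loc C)) \<and>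
       nat_trans C D F G \<alpha> \<longrightarrow>
       (nat_trans (Frac C) D Fh Gh \<alpha>h \<and> (\<forall>X \<in> Ob C. \<alpha> X = \<alpha>h (obj (loc C) X))
          \<longleftrightarrow> (\<forall>X \<in> Ob (Frac C). \<alpha>h X = \<alpha> X))) \<and>
    \<comment> \<open>(c)\<close>
    (\<forall>b1 f1 a1 b2 f2 a2 p1 g1 i1 p2 g2 i2.
       (b1, f1, a1) \<in> three_arrows C \<and> (b2, f2, a2) \<in> three_arrows C \<and>
       (p1, g1, i1) \<in> normal_three_arrows C \<and> (p2, g2, i2) \<in> normal_three_arrows C \<and>
       composable (Frac C) (dfrac C b1 f1 a1) (dfrac C p2 g2 i2) \<and>
       composable (Frac C) (dfrac C p1 g1 i1) (dfrac C b2 f2 a2) \<longrightarrow>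
       (dfrac C b1 f1 a1 \<cdot>\<^bsub>Frac C\<^esub> dfrac C p2 g2 i2 = dfrac C p1 g1 i1 \<cdot>\<^bsub>Frac C\<^esub> dfrac C b2 f2 a2
        \<longleftrightarrow>
        (\<exists>b1' f1' a1' b2' f2' a2' p1' g1' i1' p2' g2' i2'.
           (b1', f1', a1') \<in> three_arrows C \<and> (b2', f2', a2') \<in> three_arrows C \<and>
           (p1', g1', i1') \<in> normal_three_arrows C \<and> (p2', g2', i2') \<in> normal_three_arrows C \<and>
           commutes C b1' p1 p1' b1 \<and> commutes C f1' p2' p1' f1 \<and> commutes C a1' p2' p2 a1 \<and>
           commutes C b1' g1 g1' b2' \<and> commutes C f1' g2' g1' f2' \<and> commutes C a1' g2' g2 a2' \<and>
           commutes C b2 i1 i1' b2' \<and> commutes C f2 i2' i1' f2' \<and> commutes C a2 i2' i2 a2')))"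
proof -
  interpret uni_fractionable C by (fact assms)
  show ?thesis
  proof (intro conjI)
    show "category (Frac C)" by (rule category_Frac)
    show "Mor (Frac C) = {dfrac C b f a | b f a. (b, f, a) \<in> three_arrows C}" by (rule Mor_Frac)
    show "\<forall>b f a. (b, f, a) \<in> three_arrows C \<longrightarrow>
       src (Frac C) (dfrac C b f a) = tgt C b \<and> tgt (Frac C) (dfrac C b f a) = src C a"
      using src_Frac tgt_Frac by blast
    show "\<forall>b1 f1 a1 b2 f2 a2.
       (b1, f1, a1) \<in> three_arrows C \<and> (b2, f2, a2) \<in> three_arrows C \<and>
       tgt (Frac C) (dfrac C b1 f1 a1) = src (Frac C) (dfrac C b2 f2 a2) \<longrightarrow>
       (\<exists>d d' e e' g1 g2. d \<in> Den C \<and> d' \<in> Den C \<and> e \<in> Den C \<and> e' \<in> Den C \<and>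
          commutes C b2 a1 d e \<and> commutes C g1 e e' f1 \<and> commutes C d g2 f2 d') \<and>
       (\<forall>d d' e e' g1 g2. d \<in> Den C \<and> d' \<in> Den C \<and> e \<in> Den C \<and> e' \<in> Den C \<and>
          commutes C b2 a1 d e \<and> commutes C g1 e e' f1 \<and> commutes C d g2 f2 d' \<longrightarrow>
          dfrac C b1 f1 a1 \<cdot>\<^bsub>Frac C\<^esub> dfrac C b2 f2 a2 = dfrac C (e' \<cdot> b1) (g1 \<cdot> g2) (a2 \<cdot> d'))"
    proof (intro allI impI conjI; elim conjE)
      fix b1 f1 a1 b2 f2 a2
      assume t: "(b1, f1, a1) \<in> three_arrows C" "(b2, f2, a2) \<in> three_arrows C"
        and "tgt (Frac C) (dfrac C b1 f1 a1) = src (Frac C) (dfrac C b2 f2 a2)"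
      then have "src C a1 = tgt C b2" by (simp only: src_Frac tgt_Frac)
      then obtain d d' e e' g1 g2 where "composite_choice b1 f1 a1 b2 f2 a2 d d' e e' g1 g2"
        by (rule composite_choice_exists[OF t])
      then show "\<exists>d d' e e' g1 g2. d \<in> Den C \<and> d' \<in> Den C \<and> e \<in> Den C \<and> e' \<in> Den C \<and>
          commutes C b2 a1 d e \<and> commutes C g1 e e' f1 \<and> commutes C d g2 f2 d'"
        unfolding composite_choice_def by blast
    next
      fix b1 f1 a1 b2 f2 a2 d d' e e' g1 g2
      assume "(b1, f1, a1) \<in> three_arrows C" "(b2, f2, a2) \<in> three_arrows C"
        "d \<in> Den C" "d' \<in> Den C" "e \<in> Den C" "e' \<in> Den C"
        "commutes C b2 a1 d e" "commutes C g1 e e' f1" "commutes C d g2 f2 d'"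
      then have "composite_choice b1 f1 a1 b2 f2 a2 d d' e e' g1 g2"
        unfolding composite_choice_def by blast
      then show "dfrac C b1 f1 a1 \<cdot>\<^bsub>Frac C\<^esub> dfrac C b2 f2 a2 = dfrac C (e' \<cdot> b1) (g1 \<cdot> g2) (a2 \<cdot> d')"
        by (rule cmp_Frac[OF is_compositeI[OF _ HOL.refl]])
    qed
    show "is_localisation TYPE('p \<times> 'n) C (Den C) (Frac C) (loc C)" by (rule is_localisation_Frac)
    show "\<forall>f \<in> Mor C. mor (loc C) f = dfrac C (ident C (src C f)) f (ident C (tgt C f))"
      by (simp add: mor_loc)
    show "\<forall>d \<in> Den C.
       inv_mor (Frac C) (mor (loc C) d) = dfrac C d (ident C (src C d)) (ident C (src C d)) \<and>
       dfrac C d (ident C (src C d)) (ident C (src C d))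
         = dfrac C (ident C (tgt C d)) (ident C (tgt C d)) d"
      using category.inv_mor_eq[OF category_Frac is_inverse_loc] dfrac_inverse by blast
    show "\<forall>(D :: ('p, 'n) category) F Fh.
       is_functor C D F \<and> inverts (Den C) D F \<longrightarrow>
       (is_functor (Frac C) D Fh \<and> functor_eq C F (functor_comp Fh (loc C))
          \<longleftrightarrow> (\<forall>X \<in> Ob C. obj Fh X = obj F X) \<and>
              (\<forall>b f a. (b, f, a) \<in> three_arrows C \<longrightarrow>
                 mor Fh (dfrac C b f a)
                   = inv_mor D (mor F b) \<cdot>\<^bsub>D\<^esub> mor F f \<cdot>\<^bsub>D\<^esub> inv_mor D (mor F a)))"
    proof (intro allI impI, elim conjE)
      fix D :: "('p, 'n) category" and F Fh
      assume F: "is_functor C D F" "inverts (Den C) D F"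
      then interpret inverting_functor C D F
        by (intro inverting_functor.intro inverting_functor_axioms.intro uni_fractionable_axioms)
          (simp add: is_functor_def)
      show "is_functor (Frac C) D Fh \<and> functor_eq C F (functor_comp Fh (loc C))
          \<longleftrightarrow> (\<forall>X \<in> Ob C. obj Fh X = obj F X) \<and>
              (\<forall>b f a. (b, f, a) \<in> three_arrows C \<longrightarrow>
                 mor Fh (dfrac C b f a)
                   = inv_mor D (mor F b) \<cdot>\<^bsub>D\<^esub> mor F f \<cdot>\<^bsub>D\<^esub> inv_mor D (mor F a))"
        using extension_iff[of Fh] unfolding frac_value_def prod.case .
    qed
    show "\<forall>(D :: ('p, 'n) category) F G Fh Gh \<alpha> \<alpha>h.
       is_functor C D F \<and> inverts (Den C) D F \<and> is_functor C D G \<and> inverts (Den C) D G \<and>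
       is_functor (Frac C) D Fh \<and> functor_eq C F (functor_comp Fh (loc C)) \<and>
       is_functor (Frac C) D Gh \<and> functor_eq C G (functor_comp Gh (loc C)) \<and>
       nat_trans C D F G \<alpha> \<longrightarrow>
       (nat_trans (Frac C) D Fh Gh \<alpha>h \<and> (\<forall>X \<in> Ob C. \<alpha> X = \<alpha>h (obj (loc C) X))
          \<longleftrightarrow> (\<forall>X \<in> Ob (Frac C). \<alpha>h X = \<alpha> X))"
      by (intro allI impI, elim conjE) (rule nat_trans_extension_iff)
    show "\<forall>b1 f1 a1 b2 f2 a2 p1 g1 i1 p2 g2 i2.
       (b1, f1, a1) \<in> three_arrows C \<and> (b2, f2, a2) \<in> three_arrows C \<and>
       (p1, g1, i1) \<in> normal_three_arrows C \<and> (p2, g2, i2) \<in> normal_three_arrows C \<and>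
       composable (Frac C) (dfrac C b1 f1 a1) (dfrac C p2 g2 i2) \<and>
       composable (Frac C) (dfrac C p1 g1 i1) (dfrac C b2 f2 a2) \<longrightarrow>
       (dfrac C b1 f1 a1 \<cdot>\<^bsub>Frac C\<^esub> dfrac C p2 g2 i2 = dfrac C p1 g1 i1 \<cdot>\<^bsub>Frac C\<^esub> dfrac C b2 f2 a2
        \<longleftrightarrow>
        (\<exists>b1' f1' a1' b2' f2' a2' p1' g1' i1' p2' g2' i2'.
           (b1', f1', a1') \<in> three_arrows C \<and> (b2', f2', a2') \<in> three_arrows C \<and>
           (p1', g1', i1') \<in> normal_three_arrows C \<and> (p2', g2', i2') \<in> normal_three_arrows C \<and>
           commutes C b1' p1 p1' b1 \<and> commutes C f1' p2' p1' f1 \<and> commutes C a1' p2' p2 a1 \<and>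
           commutes C b1' g1 g1' b2' \<and> commutes C f1' g2' g1' f2' \<and> commutes C a1' g2' g2 a2' \<and>
           commutes C b2 i1 i1' b2' \<and> commutes C f2 i2' i1' f2' \<and> commutes C a2 i2' i2 a2'))"
      (is "\<forall>b1 f1 a1 b2 f2 a2 p1 g1 i1 p2 g2 i2. ?H b1 f1 a1 b2 f2 a2 p1 g1 i1 p2 g2 i2 \<longrightarrow>
        (?E b1 f1 a1 b2 f2 a2 p1 g1 i1 p2 g2 i2 \<longleftrightarrow> ?G b1 f1 a1 b2 f2 a2 p1 g1 i1 p2 g2 i2)")
    proof (intro allI impI)
      fix b1 f1 a1 b2 f2 a2 p1 g1 i1 p2 g2 i2
      assume "?H b1 f1 a1 b2 f2 a2 p1 g1 i1 p2 g2 i2"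
      then have t: "(b1, f1, a1) \<in> three_arrows C" "(b2, f2, a2) \<in> three_arrows C"
        and n: "(p1, g1, i1) \<in> normal_three_arrows C" "(p2, g2, i2) \<in> normal_three_arrows C"
        and c: "composable (Frac C) (dfrac C b1 f1 a1) (dfrac C p2 g2 i2)"
          "composable (Frac C) (dfrac C p1 g1 i1) (dfrac C b2 f2 a2)" by blast+
      note N = normal_three_arrowsD(1)[OF n(1)] normal_three_arrowsD(1)[OF n(2)]
      show "?E b1 f1 a1 b2 f2 a2 p1 g1 i1 p2 g2 i2 \<longleftrightarrow> ?G b1 f1 a1 b2 f2 a2 p1 g1 i1 p2 g2 i2"
      proof
        assume E: "?E b1 f1 a1 b2 f2 a2 p1 g1 i1 p2 g2 i2"
        have ends: "src C a1 = tgt C p2" "src C i1 = tgt C b2"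
          using c unfolding composable_def src_Frac[OF N(2)] src_Frac[OF t(2)]
            tgt_Frac[OF t(1)] tgt_Frac[OF N(1)] by blast+
        obtain z where z: "is_composite (b1, f1, a1) (p2, g2, i2) z"
          by (rule is_composite_exists_three_arrows[OF t(1) N(2) ends(1)])
        obtain z' where z': "is_composite (p1, g1, i1) (b2, f2, a2) z'"
          by (rule is_composite_exists_three_arrows[OF N(1) t(2) ends(2)])
        \<comment> \<open>Composability only matches the inner ends of the two products. The outer
          ends agree because the products are equal and a double fraction determines its
          ends.\<close>
        have "z = z'" using E cmp_Frac[OF z] cmp_Frac[OF z'] by simp
        then have "tgt C p1 = tgt C b1" "src C i2 = src C a2"
          using is_composite_dfrac[OF z] is_composite_dfrac[OF z'] by (metis dfrac_endpoints)+
        then show "?G b1 f1 a1 b2 f2 a2 p1 g1 i1 p2 g2 i2"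
          using ends by (intro composites_eq_imp_grid[OF t n _ _ _ _ E]) simp_all
      next
        assume "?G b1 f1 a1 b2 f2 a2 p1 g1 i1 p2 g2 i2"
        then show "?E b1 f1 a1 b2 f2 a2 p1 g1 i1 p2 g2 i2"
          by (elim exE conjE) (rule grid_imp_composites_eq[OF t _ _ n])
      qed
    qed
  qed simp_all
qed

end
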